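(* Let $\Sigma$ be a complete fan in $N_{\mathbb R}$, let $\Psi$ be a piecewise linear concave function on $\Sigma$ with integral slopes and let $g:N_{\mathbb R}\to\mathbb R$ be a convex (continuous) singular Green function for $\Psi$. Then $g$ is the pointwise limit of a decreasing sequence of convex smooth Green functions for $\Psi$.
   Context: $N$ is a free abelian group of finite rank $n$, $M=\mathrm{Hom}(N,\mathbb Z)$, $N_{\mathbb R}=N\otimes\mathbb R$, $\mathbb R_{-\infty}=\mathbb R\cup\{-\infty\}$ (topologized via $\exp$). A fan $\Sigma$ is a finite polyhedral complex of strictly convex rational polyhedral cones in $N_{\mathbb R}$; complete means support $N_{\mathbb R}$. $N_\Sigma=\coprod_{\sigma\in\Sigma}N(\sigma)$, $N(\sigma)=N_{\mathbb R}/\langle\sigma\rangle_{\mathbb R}$, with quotient maps $\pi_\sigma:N_{\mathbb R}\to N(\sigma)$, $\pi_{\sigma,\tau}:N(\tau)\to N(\sigma)$ for faces $\tau\prec\sigma$; a basis of open neighbourhoods of $p\in N(\sigma)$ is given by $\coprod_{\tau\prec\sigma}\pi_\tau(\Omega+\sigma)$, $\Omega$ bounded open convex in $N_{\mathbb R}$ with $p\in\pi_\sigma(\Omega)$. $\Psi:N_{\mathbb R}\to\mathbb R$ is piecewise linear on $\Sigma$ with integral slopes if for each $\sigma\in\Sigma$ there is $m_\sigma\in M$ with $\Psi|_\sigma=m_\sigma|_\sigma$. A continuous Green function (resp. smooth Green function, resp. continuous singular Green function) for $\Psi$ (on $U=N_\Sigma$) is a function $g:N_{\mathbb R}\to\mathbb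 R$ such that for every $\sigma\in\Sigma$ and every such $m_\sigma$ there are an open neighbourhood $\Omega_\sigma$ of $N(\sigma)$ in $N_\Sigma$ and a continuous function $h_\sigma:\Omega_\sigma\to\mathbb R$ (resp. a smooth function $h_\sigma:\Omega_\sigma\to\mathbb R$, resp. a continuous function $h_\sigma:\Omega_\sigma\to\mathbb R_{-\infty}$) extending $(g+m_\sigma)|_{\Omega_\sigma\cap N_{\mathbb R}}$. A function $f:U\to\mathbb R$ on an open $U\subset N_\Sigma$ is smooth if $f|_{U\cap N(\sigma)}$ is $C^\infty$ for each $\sigma$ and $f$ is constant towards the boundary: each $x\in U\cap N(\sigma)$ has an open neighbourhood $V\subset U$ such that for all $\tau\prec\sigma$ one has $V\cap N(\tau)=(\pi_{\sigma,\tau}|_{V\cap N(\tau)})^{-1}(V\cap N(\sigma))$ and $f=f\circ\pi_{\sigma,\tau}$ on $V\cap N(\tau)$. *)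

theory Defs
  imports "HOL-Analysis.Analysis"
begin

(* A lattice N is the set of integral combinations of a finite independent set in some ambient
   Euclidean space. N_R is then span N, a subspace that need not be the whole type: types of class
   euclidean_space have positive dimension, so this is what lets N have rank 0. Functions on N_R are
   functions on the ambient type of which only the values on span N are ever used. *)

definition is_lattice :: "'a::euclidean_space set \<Rightarrow> bool" where
  "is_lattice N \<longleftrightarrow>
     (\<exists>B. finite B \<and> independent B \<and> N = {(\<Sum>b\<in>B. of_int (c b) *\<^sub>R b) | c :: 'a \<Rightarrow> int. True})"

(* Elements of M = Hom(N,Z), represented by linear extensions to the ambient space; different
   extensions of the same element agree on span N. *)

definition dual_lattice :: "'a::euclidean_space set \<Rightarrow> ('a \<Rightarrow> real) set" where
  "dual_lattice N = {m. linear m \<and> (\<forall>v\<in>N. m v \<in> \<int>)}"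

definition rational_cone :: "'a::euclidean_space set \<Rightarrow> 'a set \<Rightarrow> bool" where
  "rational_cone N \<sigma> \<longleftrightarrow> (\<exists>T. finite T \<and> T \<subseteq> N \<and> \<sigma> = convex_cone hull T)"

definition strictly_convex_cone :: "'a::euclidean_space set \<Rightarrow> bool" where
  "strictly_convex_cone \<sigma> \<longleftrightarrow> (\<forall>v. v \<in> \<sigma> \<and> - v \<in> \<sigma> \<longrightarrow> v = 0)"

(* The library relation face_of is reflexive and also counts the empty set as a face. *)

definition fan :: "'a::euclidean_space set \<Rightarrow> 'a set set \<Rightarrow> bool" where
  "fan N \<Sigma> \<longleftrightarrow> finite \<Sigma> \<and>
     (\<forall>\<sigma>\<in>\<Sigma>. rational_cone N \<sigma> \<and> strictly_convex_cone \<sigma>) \<and>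
     (\<forall>\<sigma>\<in>\<Sigma>. \<forall>\<tau>. \<tau> face_of \<sigma> \<and> \<tau> \<noteq> {} \<longrightarrow> \<tau> \<in> \<Sigma>) \<and>
     (\<forall>\<sigma>\<in>\<Sigma>. \<forall>\<tau>\<in>\<Sigma>. (\<sigma> \<inter> \<tau>) face_of \<sigma> \<and> (\<sigma> \<inter> \<tau>) face_of \<tau>)"

definition complete_fan :: "'a::euclidean_space set \<Rightarrow> 'a set set \<Rightarrow> bool" where
  "complete_fan N \<Sigma> \<longleftrightarrow> fan N \<Sigma> \<and> \<Union>\<Sigma> = span N"

(* A point of N(\<sigma>) = N_R / span \<sigma> is a coset of span \<sigma>, tagged with \<sigma> because different cones may
   have the same span. Thus N_\<Sigma> consists of pairs, and N_R itself is the stratum of the cone {0}. *)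

definition quot_proj :: "'a::euclidean_space set \<Rightarrow> 'a \<Rightarrow> 'a set \<times> 'a set" where
  "quot_proj \<sigma> v = (\<sigma>, {v + w | w. w \<in> span \<sigma>})"

definition stratum :: "'a::euclidean_space set \<Rightarrow> 'a set \<Rightarrow> ('a set \<times> 'a set) set" where
  "stratum N \<sigma> = quot_proj \<sigma> ` span N"

abbreviation embed_NR :: "'a::euclidean_space \<Rightarrow> 'a set \<times> 'a set" where
  "embed_NR v \<equiv> quot_proj {0} v"

(* The map N(\<tau>) \<rightarrow> N(\<sigma>) induced by the identity of N_R, for \<tau> a face of \<sigma>. *)

definition strata_proj :: "'a::euclidean_space set \<Rightarrow> 'a set \<times> 'a set \<Rightarrow> 'a set \<times> 'a set" where
  "strata_proj \<sigma> y = (\<sigma>, {a + w | a w. a \<in> snd y \<and> w \<in> span \<sigma>})"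

definition basic_nhd ::
  "'a::euclidean_space set set \<Rightarrow> 'a set \<Rightarrow> 'a set \<Rightarrow> ('a set \<times> 'a set) set" where
  "basic_nhd \<Sigma> \<sigma> \<Omega> =
     (\<Union>\<tau>\<in>{\<tau>\<in>\<Sigma>. \<tau> face_of \<sigma>}. quot_proj \<tau> ` {x + s | x s. x \<in> \<Omega> \<and> s \<in> \<sigma>})"

(* Each basic_nhd \<Sigma> \<sigma> \<Omega> is a basic neighbourhood of every p in quot_proj \<sigma> ` \<Omega>, so these sets form
   a base of the topology; its carrier is the disjoint union of the strata. *)

definition N_Sigma ::
  "'a::euclidean_space set \<Rightarrow> 'a set set \<Rightarrow> ('a set \<times> 'a set) topology" where
  "N_Sigma N \<Sigma> = topology_generated_by
     {basic_nhd \<Sigma> \<sigma> \<Omega> | \<sigma> \<Omega>.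
        \<sigma> \<in> \<Sigma> \<and> openin (top_of_set (span N)) \<Omega> \<and> convex \<Omega> \<and> bounded \<Omega>}"

definition piecewise_linear_integral ::
  "'a::euclidean_space set \<Rightarrow> 'a set set \<Rightarrow> ('a \<Rightarrow> real) \<Rightarrow> bool" where
  "piecewise_linear_integral N \<Sigma> \<Psi> \<longleftrightarrow> (\<forall>\<sigma>\<in>\<Sigma>. \<exists>m\<in>dual_lattice N. \<forall>v\<in>\<sigma>. \<Psi> v = m v)"

(* Ck_on V k S f: f is of class C^k on S, where S is relatively open in the subspace V. Then the
   derivative of f within S at a point of S is unique on V, and only directions in V are iterated. *)

primrec Ck_on ::
  "'a::euclidean_space set \<Rightarrow> nat \<Rightarrow> 'a set \<Rightarrow> ('a \<Rightarrow> real) \<Rightarrow> bool" where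
  "Ck_on V 0 S f = continuous_on S f"
| "Ck_on V (Suc k) S f =
     (\<exists>f'. (\<forall>x\<in>S. (f has_derivative f' x) (at x within S)) \<and>
           (\<forall>v\<in>V. Ck_on V k S (\<lambda>x. f' x v)))"

definition Cinf_on :: "'a::euclidean_space set \<Rightarrow> 'a set \<Rightarrow> ('a \<Rightarrow> real) \<Rightarrow> bool" where
  "Cinf_on V S f \<longleftrightarrow> (\<forall>k. Ck_on V k S f)"

(* The first conjunct says that f is C^\<infinity> on U \<inter> N(\<sigma>): the smooth structure of the quotient space
   N(\<sigma>) is the one for which a function is smooth iff its pullback to N_R is. *)

definition smooth_on_N_Sigma ::
  "'a::euclidean_space set \<Rightarrow> 'a set set \<Rightarrow> ('a set \<times> 'a set) set \<Rightarrow>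
     ('a set \<times> 'a set \<Rightarrow> real) \<Rightarrow> bool" where
  "smooth_on_N_Sigma N \<Sigma> U f \<longleftrightarrow>
     (\<forall>\<sigma>\<in>\<Sigma>. Cinf_on (span N) {v \<in> span N. quot_proj \<sigma> v \<in> U} (\<lambda>v. f (quot_proj \<sigma> v))) \<and>
     (\<forall>\<sigma>\<in>\<Sigma>. \<forall>x \<in> U \<inter> stratum N \<sigma>. \<exists>V. openin (N_Sigma N \<Sigma>) V \<and> x \<in> V \<and> V \<subseteq> U \<and>
        (\<forall>\<tau>\<in>\<Sigma>. \<tau> face_of \<sigma> \<longrightarrow>
           V \<inter> stratum N \<tau> = {y \<in> V \<inter> stratum N \<tau>. strata_proj \<sigma> y \<in> V \<inter> stratum N \<sigma>} \<and>
           (\<forall>y \<in> V \<inter> stratum N \<tau>. f y = f (strata_proj \<sigma> y))))"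

definition smooth_Green_function ::
  "'a::euclidean_space set \<Rightarrow> 'a set set \<Rightarrow> ('a \<Rightarrow> real) \<Rightarrow> ('a \<Rightarrow> real) \<Rightarrow> bool" where
  "smooth_Green_function N \<Sigma> \<Psi> g \<longleftrightarrow>
     (\<forall>\<sigma>\<in>\<Sigma>. \<forall>m\<in>dual_lattice N. (\<forall>v\<in>\<sigma>. \<Psi> v = m v) \<longrightarrow>
        (\<exists>U h. openin (N_Sigma N \<Sigma>) U \<and> stratum N \<sigma> \<subseteq> U \<and>
           smooth_on_N_Sigma N \<Sigma> U h \<and>
           (\<forall>v\<in>span N. embed_NR v \<in> U \<longrightarrow> h (embed_NR v) = g v + m v)))"

(* The values h lie in R \<union> {-\<infinity>}, taken as a subspace of ereal; via exp it is homeomorphic to the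
   half-line of nonnegative reals. *)

definition singular_Green_function ::
  "'a::euclidean_space set \<Rightarrow> 'a set set \<Rightarrow> ('a \<Rightarrow> real) \<Rightarrow> ('a \<Rightarrow> real) \<Rightarrow> bool" where
  "singular_Green_function N \<Sigma> \<Psi> g \<longleftrightarrow>
     (\<forall>\<sigma>\<in>\<Sigma>. \<forall>m\<in>dual_lattice N. (\<forall>v\<in>\<sigma>. \<Psi> v = m v) \<longrightarrow>
        (\<exists>U h. openin (N_Sigma N \<Sigma>) U \<and> stratum N \<sigma> \<subseteq> U \<and>
           continuous_map (subtopology (N_Sigma N \<Sigma>) U) (top_of_set {x::ereal. x \<noteq> \<infinity>}) h \<and>
           (\<forall>v\<in>span N. embed_NR v \<in> U \<longrightarrow> h (embed_NR v) = ereal (g v + m v))))"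

end

theory Submission
  imports Defs
begin

text \<open>
Write \<open>V = span N\<close> and \<open>H = - \<Psi>\<close>. Since \<open>\<Psi>\<close> is concave and positively homogeneous,
\<open>H\<close> is sublinear, and it is linear on every cone of the fan. A singular Green function is bounded
above after adding \<open>m\<^sub>\<sigma>\<close> near the stratum of \<open>\<sigma>\<close>; for a convex function such a bound along a ray
in direction \<open>w\<close> limits the slope, which gives the global inequality
\<open>g (a + w) \<le> g a + H w\<close> (\<open>singular_Green_function_growth\<close>). The approximation is
built from this inequality and the convexity of \<open>g\<close>.

The inequality says that \<open>g\<close> is its own infimal convolution with \<open>H\<close>. Restricting the infimum to a
ball, \<open>g\<^sub>j v = inf {g y + H (v - y) | norm y \<le> j}\<close>, yields convex functions that decrease with \<open>j\<close>,
lie above \<open>g\<close>, and agree with \<open>g\<close> on the ball of radius \<open>j\<close>. They inherit their behaviour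
at infinity from \<open>H\<close>, because \<open>y\<close> stays bounded. That behaviour is as follows. If \<open>s\<close> lies in
the relative interior of \<open>\<sigma>\<close> and \<open>x\<close> stays bounded, then \<open>x + T s\<close> for large \<open>T\<close> lies in a cone
that contains \<open>\<sigma>\<close>, as the fan is complete; on that cone \<open>H\<close> is linear, so
\<open>H (x + T s + t) = H (x + T s) + H t\<close> for all \<open>t\<close> in \<open>\<sigma>\<close>. This property, called
\<open>asymptotically_additive\<close> below, expresses the constancy of \<open>H + m\<^sub>\<sigma>\<close> towards the boundary.

Averaging \<open>g\<^sub>j\<close> against a smooth bump function of small support makes it smooth and preserves
convexity and asymptotic additivity. Since \<open>H\<close> is bounded by a multiple of the norm, \<open>g\<^sub>j\<close> is
Lipschitz with a constant independent of \<open>j\<close>, so the averaging error is at most \<open>2\<^sup>-\<^sup>j\<close> for a suitable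
support, and adding \<open>3 * 2\<^sup>-\<^sup>j\<close> makes the sequence decreasing
(\<open>smooth_decreasing_approximation\<close>). Finally a smooth asymptotically additive function is a smooth
Green function (\<open>smooth_Green_functionI\<close>): the values that it takes deep inside a cone, after
adding \<open>m\<^sub>\<sigma>\<close>, define its extension to the stratum.
\<close>

section \<open>Calculus of iterated derivatives\<close>

lemma Ck_on_SucI:
  assumes "\<And>x. x \<in> S \<Longrightarrow> (f has_derivative f' x) (at x within S)"
    and "\<And>v. v \<in> V \<Longrightarrow> Ck_on V k S (\<lambda>x. f' x v)"
  shows "Ck_on V (Suc k) S f"
  using assms by auto

lemma Ck_on_SucE:
  assumes "Ck_on V (Suc k) S f"
  obtains f' where "\<And>x. x \<in> S \<Longrightarrow> (f has_derivative f' x) (at x within S)"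
    and "\<And>v. v \<in> V \<Longrightarrow> Ck_on V k S (\<lambda>x. f' x v)"
  using assms unfolding Ck_on.simps by blast

lemma Ck_on_restrict:
  "Ck_on UNIV k UNIV f \<Longrightarrow> Ck_on V k S f"
proof (induction k arbitrary: f)
  case 0
  then show ?case using continuous_on_subset by auto
next
  case (Suc k)
  then obtain f' where f': "\<And>x. (f has_derivative f' x) (at x)" "\<And>v. Ck_on UNIV k UNIV (\<lambda>x. f' x v)"
    by auto
  then show ?case
    by (rule Ck_on_SucI[OF has_derivative_at_withinI Suc.IH])
qed

lemma Ck_on_cong:
  "(\<And>x. x \<in> S \<Longrightarrow> f x = g x) \<Longrightarrow> Ck_on V k S g \<Longrightarrow> Ck_on V k S f"
proof (cases k)
  case 0
  assume "\<And>x. x \<in> S \<Longrightarrow> f x = g x" "Ck_on V k S g"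
  then show ?thesis using 0 continuous_on_cong[of S S f g] by simp
next
  case (Suc j)
  assume fg: "\<And>x. x \<in> S \<Longrightarrow> f x = g x" and "Ck_on V k S g"
  from this(2)[unfolded Suc]
  obtain g' where g': "\<And>x. x \<in> S \<Longrightarrow> (g has_derivative g' x) (at x within S)"
    "\<And>v. v \<in> V \<Longrightarrow> Ck_on V j S (\<lambda>x. g' x v)"
    by (rule Ck_on_SucE) blast
  have "(f has_derivative g' x) (at x within S)" if "x \<in> S" for x
    using has_derivative_transform[OF that fg g'(1)[OF that]] by simp
  then show ?thesis unfolding Suc using g'(2) by (rule Ck_on_SucI)
qed

lemma Ck_on_imp_continuous_on: "Ck_on V k S f \<Longrightarrow> continuous_on S f"
proof (cases k)
  case (Suc j)
  assume "Ck_on V k S f"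
  then show ?thesis
    unfolding Suc by (elim Ck_on_SucE) (rule has_derivative_continuous_on)
qed simp

lemma Ck_on_Suc_imp: "Ck_on V (Suc k) S f \<Longrightarrow> Ck_on V k S f"
proof (induction k arbitrary: f)
  case 0
  then show ?case using Ck_on_imp_continuous_on[OF 0] by simp
next
  case (Suc k)
  from Suc.prems obtain f' where
    "\<And>x. x \<in> S \<Longrightarrow> (f has_derivative f' x) (at x within S)"
    "\<And>v. v \<in> V \<Longrightarrow> Ck_on V (Suc k) S (\<lambda>x. f' x v)"
    by (rule Ck_on_SucE) blast
  then show ?case
    by (rule Ck_on_SucI[OF _ Suc.IH])
qed

lemma Ck_on_const: "Ck_on V k S (\<lambda>x. c)"
proof (induction k arbitrary: c)
  case (Suc k)
  have "((\<lambda>x. c) has_derivative (\<lambda>v. 0)) (at x within S)" for x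
    by simp
  then show ?case by (rule Ck_on_SucI) (rule Suc)
qed simp

lemma Ck_on_linear:
  assumes "bounded_linear f"
  shows "Ck_on V k S f"
proof (cases k)
  case 0
  then show ?thesis using assms by (simp add: linear_continuous_on)
next
  case (Suc j)
  have "(f has_derivative f) (at x within S)" for x
    using assms by (rule bounded_linear_imp_has_derivative)
  then show ?thesis
    unfolding Suc by (rule Ck_on_SucI) (rule Ck_on_const)
qed

lemma Ck_on_add:
  "Ck_on V k S f \<Longrightarrow> Ck_on V k S g \<Longrightarrow> Ck_on V k S (\<lambda>x. f x + g x)"
proof (induction k arbitrary: f g)
  case 0
  then show ?case by (simp add: continuous_on_add continuous_on_mult)
next
  case (Suc k)
  from Suc.prems obtain f' g' where
    d: "\<And>x. x \<in> S \<Longrightarrow> (f has_derivative f' x) (at x within S)"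
      "\<And>v. v \<in> V \<Longrightarrow> Ck_on V k S (\<lambda>x. f' x v)"
      "\<And>x. x \<in> S \<Longrightarrow> (g has_derivative g' x) (at x within S)"
      "\<And>v. v \<in> V \<Longrightarrow> Ck_on V k S (\<lambda>x. g' x v)"
    by (elim Ck_on_SucE) blast
  show ?case
    by (rule Ck_on_SucI[OF has_derivative_add[OF d(1) d(3)] Suc.IH[OF d(2) d(4)]])
qed

text \<open>
Only the directional derivatives are iterated, so the product rule closes the induction once it is
known that a function of class \<open>C\<^sup>k\<^sup>+\<^sup>1\<close> is also of class \<open>C\<^sup>k\<close>.
\<close>

lemma Ck_on_mult:
  "Ck_on V k S f \<Longrightarrow> Ck_on V k S g \<Longrightarrow> Ck_on V k S (\<lambda>x. f x * g x)"
proof (induction k arbitrary: f g)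
  case 0
  then show ?case by (simp add: continuous_on_add continuous_on_mult)
next
  case (Suc k)
  from Suc.prems obtain f' g' where
    d: "\<And>x. x \<in> S \<Longrightarrow> (f has_derivative f' x) (at x within S)"
      "\<And>v. v \<in> V \<Longrightarrow> Ck_on V k S (\<lambda>x. f' x v)"
      "\<And>x. x \<in> S \<Longrightarrow> (g has_derivative g' x) (at x within S)"
      "\<And>v. v \<in> V \<Longrightarrow> Ck_on V k S (\<lambda>x. g' x v)"
    by (elim Ck_on_SucE) blast
  have "Ck_on V k S (\<lambda>x. f x * g' x v + f' x v * g x)" if "v \<in> V" for v
    by (intro Ck_on_add Suc.IH d(2) d(4) that Suc.prems[THEN Ck_on_Suc_imp])
  with has_derivative_mult[OF d(1) d(3)] show ?case
    by (rule Ck_on_SucI)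
qed

lemma Ck_on_translate:
  "Ck_on UNIV k UNIV f \<Longrightarrow> Ck_on UNIV k UNIV (\<lambda>x. f (x + a))"
proof (induction k arbitrary: f)
  case 0
  have "continuous_on UNIV f" using 0 by simp
  then have "continuous_on UNIV (\<lambda>x. f (x + a))"
    by (rule continuous_on_compose2) (auto intro: continuous_intros)
  then show ?case by simp
next
  case (Suc k)
  then obtain f' where f': "\<And>x. (f has_derivative f' x) (at x)" "\<And>v. Ck_on UNIV k UNIV (\<lambda>x. f' x v)"
    by auto
  have "((\<lambda>x. f (x + a)) has_derivative f' (x + a)) (at x)" for x
  proof -
    have "((\<lambda>x. x + a) has_derivative (\<lambda>v. v)) (at x)"
      using has_derivative_add[OF has_derivative_ident has_derivative_const[of a]] by simp
    from has_derivative_compose[OF this f'(1)] show ?thesis .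
  qed
  then show ?case
    by (rule Ck_on_SucI) (rule Suc.IH[OF f'(2)])
qed

text \<open>
Being of class \<open>C\<^sup>k\<close> is a local property. On the whole space the derivative is unique, so the
derivatives of the local representatives fit together to one derivative of \<open>q\<close>.
\<close>

lemma Ck_on_glue:
  assumes "\<And>x. \<exists>T f. open T \<and> x \<in> T \<and> Ck_on UNIV k UNIV f \<and> (\<forall>y\<in>T. f y = q y)"
  shows "Ck_on UNIV k UNIV q"
  using assms
proof (induction k arbitrary: q)
  case 0
  have "isCont q x" for x
  proof -
    obtain T f where T: "open T" "x \<in> T" "Ck_on UNIV 0 UNIV f" "\<forall>y\<in>T. f y = q y"
      using 0[of x] by (elim exE conjE)
    have f: "isCont f x"
      using T(3) by (simp add: continuous_on_eq_continuous_at)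
    have "\<forall>\<^sub>F y in nhds x. f y = q y"
      unfolding eventually_nhds using T by (intro exI[of _ T] conjI)
    then show ?thesis using f isCont_cong[of f q x] by simp
  qed
  then show ?case by (simp add: continuous_at_imp_continuous_on)
next
  case (Suc k)
  have "\<exists>T f'. open T \<and> x \<in> T \<and> (\<forall>v. Ck_on UNIV k UNIV (\<lambda>y. f' y v)) \<and>
      (\<forall>y\<in>T. (q has_derivative f' y) (at y))" for x
  proof -
    obtain T f where T: "open T" "x \<in> T" "Ck_on UNIV (Suc k) UNIV f" "\<forall>y\<in>T. f y = q y"
      using Suc.prems[of x] by (elim exE conjE)
    from T(3) obtain f' where
      f': "\<And>x. (f has_derivative f' x) (at x)" "\<And>v. Ck_on UNIV k UNIV (\<lambda>x. f' x v)"
      by (elim Ck_on_SucE) auto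
    have "(q has_derivative f' y) (at y)" if "y \<in> T" for y
      by (rule has_derivative_transform_within_open[OF f'(1) T(1) that]) (simp add: T(4))
    then show ?thesis using T(1,2) f'(2) by (intro exI[of _ T] exI[of _ f']) simp
  qed
  then obtain T f' where T: "\<And>x. open (T x)" "\<And>x. x \<in> T x"
    and f': "\<And>x v. Ck_on UNIV k UNIV (\<lambda>y. f' x y v)"
    and q: "\<And>x y. y \<in> T x \<Longrightarrow> (q has_derivative f' x y) (at y)"
    by metis
  have "Ck_on UNIV k UNIV (\<lambda>x. f' x x v)" for v
  proof (rule Suc.IH)
    fix x
    have "f' x y v = f' y y v" if "y \<in> T x" for y
      using has_derivative_unique[OF q[OF that] q[OF T(2)]] by simp
    then show "\<exists>S f. open S \<and> x \<in> S \<and> Ck_on UNIV k UNIV f \<and> (\<forall>y\<in>S. f y = f' y y v)"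
      using T[of x] f' by (intro exI[of _ "T x"] exI[of _ "\<lambda>y. f' x y v"]) simp
  qed
  with q[OF T(2)] show ?case by (rule Ck_on_SucI)
qed

section \<open>Averages against a smooth bump function\<close>

text \<open>
The classical flat function \<open>exp (- 1 / t)\<close>, together with the factors \<open>t\<^sup>-\<^sup>n\<close> that make the
family closed under differentiation.
\<close>

definition flat_exp :: "nat \<Rightarrow> real \<Rightarrow> real" where
  "flat_exp n t = (if t > 0 then exp (- (1 / t)) / t ^ n else 0)"

text \<open>
One term of the exponential series of \<open>1 / t\<close> suffices. The exponent 2 is what makes the derivative
at 0 vanish.
\<close>

lemma flat_exp_le_square:
  obtains C where "\<And>t. \<bar>flat_exp n t\<bar> \<le> C * t\<^sup>2"
proof
  fix t :: real
  show "\<bar>flat_exp n t\<bar> \<le> fact (n + 2) * t\<^sup>2"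
  proof (cases "t > 0")
    case True
    have "(1 / t) ^ (n + 2) / fact (n + 2) \<le> exp (1 / t)"
    proof -
      have "(1/t) ^ (n + 2) /\<^sub>R fact (n + 2) \<le> (\<Sum>k. (1/t) ^ k /\<^sub>R fact k)"
        using True
        by (intro order_trans[OF _ sum_le_suminf[of "\<lambda>k. (1/t) ^ k /\<^sub>R fact k" "{n + 2}"]])
           (use True summable_exp_generic[of "1/t"] in auto)
      then show ?thesis by (simp add: exp_def divide_inverse mult.commute)
    qed
    then have "exp (- (1 / t)) \<le> fact (n + 2) * t ^ (n + 2)"
      using True by (simp del: fact_Suc power_Suc add: exp_minus field_simps)
    then show ?thesis
      using True by (simp del: fact_Suc add: flat_exp_def field_simps power_add power2_eq_square)
  qed (simp add: flat_exp_def)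
qed

lemma flat_exp_deriv:
  "(flat_exp n has_real_derivative flat_exp (n + 2) t - real n * flat_exp (n + 1) t) (at t)"
proof -
  consider "t > 0" | "t < 0" | "t = 0" by linarith
  then show ?thesis
  proof cases
    case 1
    have "((\<lambda>t. exp (- (1 / t)) / t ^ n) has_real_derivative
        flat_exp (n + 2) t - real n * flat_exp (n + 1) t) (at t)"
    proof (cases n)
      case 0
      then show ?thesis
        using 1 by (auto intro!: derivative_eq_intros simp: flat_exp_def field_simps power2_eq_square)
    next
      case (Suc m)
      have "((\<lambda>t. exp (- (1 / t)) / t ^ n) has_real_derivative
          (exp (- (1 / t)) * (1 / t\<^sup>2) * t ^ n - exp (- (1 / t)) * (real n * t ^ (n - 1))) / (t ^ n * t ^ n)) (at t)"
        using 1 by (auto intro!: derivative_eq_intros simp: power2_eq_square)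
      also have "(exp (- (1 / t)) * (1 / t\<^sup>2) * t ^ n - exp (- (1 / t)) * (real n * t ^ (n - 1))) / (t ^ n * t ^ n)
          = flat_exp (n + 2) t - real n * flat_exp (n + 1) t"
        using 1 by (simp add: Suc flat_exp_def field_simps power2_eq_square)
      finally show ?thesis .
    qed
    then show ?thesis
      by (rule has_field_derivative_transform_within_open[where S="{0<..}"])
         (use 1 in \<open>auto simp: flat_exp_def\<close>)
  next
    case 2
    have "((\<lambda>t. 0) has_real_derivative flat_exp (n + 2) t - real n * flat_exp (n + 1) t) (at t)"
      using 2 by (simp add: flat_exp_def)
    then show ?thesis
      by (rule has_field_derivative_transform_within_open[where S="{..<0}"])
         (use 2 in \<open>auto simp: flat_exp_def\<close>)
  next
    case 3
    obtain C where C: "\<And>t. \<bar>flat_exp n t\<bar> \<le> C * t\<^sup>2"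
      using flat_exp_le_square by blast
    have "((\<lambda>h. flat_exp n h / h) \<longlongrightarrow> 0) (at 0)"
    proof (rule Lim_null_comparison)
      have "norm (flat_exp n h / h) \<le> C * \<bar>h\<bar>" if "h \<noteq> 0" for h
        using C[of h] that by (simp add: field_simps power2_eq_square abs_mult_self_eq)
      then show "\<forall>\<^sub>F h in at 0. norm (flat_exp n h / h) \<le> C * \<bar>h\<bar>"
        by (simp add: eventually_at_filter)
      show "((\<lambda>h. C * \<bar>h\<bar>) \<longlongrightarrow> 0) (at 0)"
        by (rule tendsto_eq_intros refl | simp)+
    qed
    then show ?thesis
      using 3 by (simp add: DERIV_def flat_exp_def)
  qed
qed

text \<open>
The induction runs over all \<open>n\<close> at once, because each derivative is a combination of two members of
the family with larger indices.
\<close>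

lemma Ck_on_bump: "Ck_on UNIV k UNIV (\<lambda>x::'a::euclidean_space. flat_exp n (r - x \<bullet> x))"
proof (induction k arbitrary: n)
  case 0
  have "continuous_on UNIV (flat_exp n)"
    using flat_exp_deriv DERIV_isCont by (metis continuous_at_imp_continuous_on)
  then have "continuous_on UNIV (\<lambda>x::'a. flat_exp n (r - x \<bullet> x))"
    by (rule continuous_on_compose2) (intro continuous_intros subset_UNIV)+
  then show ?case by simp
next
  case (Suc k)
  let ?d = "\<lambda>x. flat_exp (n + 2) (r - x \<bullet> x) + (- real n) * flat_exp (n + 1) (r - x \<bullet> x)"
  have "((\<lambda>x. flat_exp n (r - x \<bullet> x)) has_derivative (\<lambda>v. ?d x * (- 2 * (x \<bullet> v)))) (at x)" for x :: 'a
  proof -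
    have "((\<lambda>x. r - x \<bullet> x) has_derivative (\<lambda>v. - 2 * (x \<bullet> v))) (at x)"
      by (rule derivative_eq_intros refl | simp add: inner_commute)+
    from has_derivative_compose[OF this flat_exp_deriv[unfolded has_field_derivative_def]]
    show ?thesis by (simp add: algebra_simps)
  qed
  moreover have "Ck_on UNIV k UNIV (\<lambda>x. ?d x * (- 2 * (x \<bullet> v)))" for v :: 'a
    by (intro Ck_on_mult Ck_on_add Ck_on_const Suc.IH Ck_on_linear bounded_linear_inner_left)
  ultimately show ?case
    by (rule Ck_on_SucI[of _ _ "\<lambda>x v. ?d x * (- 2 * (x \<bullet> v))"])
qed

definition convolution :: "('a::euclidean_space \<Rightarrow> real) \<Rightarrow> ('a \<Rightarrow> real) \<Rightarrow> 'a \<Rightarrow> real" where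
  "convolution F D x = integral UNIV (\<lambda>y. F y * D (x - y))"

lemma convolution_eq_integral_cbox:
  assumes "\<And>z. z \<notin> cball 0 r \<Longrightarrow> D z = 0" and "cball x r \<subseteq> cbox a b"
  shows "convolution F D x = integral (cbox a b) (\<lambda>y. F y * D (x - y))"
proof -
  have "D (x - y) = 0" if "y \<notin> cbox a b" for y
    using assms(2) that by (intro assms(1)) (auto simp: dist_norm norm_minus_commute)
  then have "(\<lambda>y. F y * D (x - y)) = (\<lambda>y. if y \<in> cbox a b then F y * D (x - y) else 0)"
    by auto
  then show ?thesis
    unfolding convolution_def using Henstock_Kurzweil_Integration.integral_restrict_UNIV[of "cbox a b" "\<lambda>y. F y * D (x - y)"] by simp
qed

text \<open>
Near a given point one box contains the supports of all translates, so that differentiation under the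
integral sign takes place over a fixed box.
\<close>

lemma convolution_local_box:
  fixes p :: "'a::euclidean_space"
  obtains a b where "\<And>x. x \<in> ball p 1 \<Longrightarrow> cball x r \<subseteq> cbox a b"
proof -
  obtain a where a: "cball p (r + 1) \<subseteq> cbox (- a) a"
    using bounded_subset_cbox_symmetric bounded_cball by blast
  have "cball x r \<subseteq> cball p (r + 1)" if "x \<in> ball p 1" for x
    using that by (simp add: cball_subset_cball_iff dist_commute)
  with a that show thesis by blast
qed

text \<open>
The two forms of the convolution have different uses: moving the variable into \<open>D\<close> gives smoothness,
moving it into \<open>F\<close> shows the result as an average of translates of \<open>F\<close>.
\<close>

lemma convolution_translate:
  fixes x :: "'a::euclidean_space"
  assumes D: "\<And>z. z \<notin> cball 0 r \<Longrightarrow> D z = 0" and box: "cball 0 r \<subseteq> cbox (- c) c"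
    and F: "continuous_on UNIV F" and cD: "continuous_on UNIV D"
  shows "convolution F D x = integral (cbox (- c) c) (\<lambda>z. F (x - z) * D z)"
proof -
  have sub: "cball x r \<subseteq> cbox (x - c) (x + c)"
  proof
    fix y assume "y \<in> cball x r"
    then have "y - x \<in> cbox (- c) c"
      using box by (auto simp: dist_norm norm_minus_commute)
    then show "y \<in> cbox (x - c) (x + c)"
      by (force simp: mem_box inner_diff_left inner_add_left)
  qed
  have "(\<lambda>y. F y * D (x - y)) integrable_on cbox (x - c) (x + c)"
    by (intro integrable_continuous continuous_intros continuous_on_subset[OF F]
        continuous_on_compose2[OF cD]) auto
  then have "((\<lambda>y. F y * D (x - y)) has_integral convolution F D x) (cbox (x - c) (x + c))"
    using convolution_eq_integral_cbox[OF D sub] by (simp add: integrable_integral)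
  from has_integral_affinity[OF this, of "-1" x]
  have "((\<lambda>z. F (x - z) * D z) has_integral convolution F D x) ((\<lambda>y. x - y) ` cbox (x - c) (x + c))"
    by simp
  also have "(\<lambda>y. x - y) ` cbox (x - c) (x + c) = cbox (- c) c"
  proof (intro equalityI subsetI)
    fix z assume "z \<in> cbox (- c) c"
    then have "z = x - (x - z)" "x - z \<in> cbox (x - c) (x + c)"
      by (force simp: mem_box inner_diff_left inner_add_left)+
    then show "z \<in> (\<lambda>y. x - y) ` cbox (x - c) (x + c)" by blast
  qed (force simp: mem_box inner_diff_left inner_add_left)
  finally show ?thesis by (simp add: integral_unique)
qed

lemma has_derivative_convolution:
  fixes F D :: "'a::euclidean_space \<Rightarrow> real"
  assumes F: "continuous_on UNIV F"
    and D0: "\<And>z. z \<notin> cball 0 r \<Longrightarrow> D z = 0"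
    and D': "\<And>z. (D has_derivative D' z) (at z)" "\<And>v. continuous_on UNIV (\<lambda>z. D' z v)"
    and D'0: "\<And>z v. z \<notin> cball 0 r \<Longrightarrow> D' z v = 0"
  shows "(convolution F D has_derivative (\<lambda>v. convolution F (\<lambda>z. D' z v) p)) (at p)"
proof -
  obtain a b where ab: "\<And>x. x \<in> ball p 1 \<Longrightarrow> cball x r \<subseteq> cbox a b"
    using convolution_local_box by blast
  have cD: "continuous_on UNIV D"
    by (rule has_derivative_continuous_on) (use D'(1) in simp)
  \<comment> \<open>The rule for parameter integrals needs the derivative as a continuous map into bounded operators.\<close>
  define B where "B z = Blinfun (D' z)" for z
  have B: "blinfun_apply (B z) = D' z" for z
    unfolding B_def using D'(1) by (intro bounded_linear_Blinfun_apply has_derivative_bounded_linear)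
  have cB: "continuous_on UNIV B"
    by (rule continuous_on_blinfun_componentwise) (simp add: B D'(2))
  define fx where "fx x y = F y *\<^sub>R B (x - y)" for x y
  have cfx: "continuous_on X (\<lambda>(x, y). fx x y)" for X
    unfolding fx_def split_beta
    by (intro continuous_intros continuous_on_compose2[OF F] continuous_on_compose2[OF cB]) auto
  have cfx1: "continuous_on X (fx x)" for X x
    unfolding fx_def
    by (intro continuous_intros continuous_on_compose2[OF F] continuous_on_compose2[OF cB]) auto
  have "((\<lambda>x. integral (cbox a b) (\<lambda>y. F y * D (x - y))) has_derivative
      blinfun_apply (integral (cbox a b) (fx p))) (at p within ball p 1)"
  proof (rule leibniz_rule)
    fix x t assume "x \<in> ball p 1"
    have "((\<lambda>x. x - t) has_derivative (\<lambda>v. v)) (at x within ball p 1)"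
      using has_derivative_diff[OF has_derivative_ident has_derivative_const[of t]] by simp
    from has_derivative_mult_right[OF has_derivative_compose[OF this D'(1)], of "F t"]
    show "((\<lambda>x. F t * D (x - t)) has_derivative blinfun_apply (fx x t)) (at x within ball p 1)"
      by (simp add: fx_def scaleR_blinfun.rep_eq B)
  next
    show "(\<lambda>y. F y * D (x - y)) integrable_on cbox a b" for x
      by (intro integrable_continuous continuous_intros continuous_on_subset[OF F]
          continuous_on_compose2[OF cD]) auto
  qed (use cfx in auto)
  then have "((\<lambda>x. integral (cbox a b) (\<lambda>y. F y * D (x - y))) has_derivative
      blinfun_apply (integral (cbox a b) (fx p))) (at p)"
    by (simp add: at_within_open[of _ "ball p 1"])
  then have "(convolution F D has_derivative blinfun_apply (integral (cbox a b) (fx p))) (at p)"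
  proof (rule has_derivative_transform_within_open[where s="ball p 1"])
    fix x assume "x \<in> ball p 1"
    from ab[OF this] show "integral (cbox a b) (\<lambda>y. F y * D (x - y)) = convolution F D x"
      by (intro sym[OF convolution_eq_integral_cbox] D0)
  qed auto
  moreover
  have "blinfun_apply (integral (cbox a b) (fx p)) v = convolution F (\<lambda>z. D' z v) p" for v
  proof -
    have "blinfun_apply (integral (cbox a b) (fx p)) v = integral (cbox a b) (\<lambda>y. fx p y v)"
      by (rule blinfun_apply_integral[OF integrable_continuous[OF cfx1]])
    also have "\<dots> = convolution F (\<lambda>z. D' z v) p"
    proof -
      have "convolution F (\<lambda>z. D' z v) p = integral (cbox a b) (\<lambda>y. F y * D' (p - y) v)"
        by (intro convolution_eq_integral_cbox[where r=r] D'0 ab[of p]) simp_all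
      then show ?thesis by (simp add: fx_def scaleR_blinfun.rep_eq B)
    qed
    finally show ?thesis .
  qed
  then have "blinfun_apply (integral (cbox a b) (fx p)) = (\<lambda>v. convolution F (\<lambda>z. D' z v) p)"
    by (rule ext)
  ultimately show ?thesis by simp
qed

text \<open>
All derivatives fall on \<open>D\<close>, and the directional derivatives of \<open>D\<close> vanish outside the same ball.
\<close>

lemma Ck_on_convolution:
  fixes F D :: "'a::euclidean_space \<Rightarrow> real"
  assumes F: "continuous_on UNIV F"
  assumes "Ck_on UNIV k UNIV D" "\<And>z. z \<notin> cball 0 r \<Longrightarrow> D z = 0"
  shows "Ck_on UNIV k UNIV (convolution F D)"
  using assms(2,3)
proof (induction k arbitrary: D)
  case 0
  have cD: "continuous_on UNIV D" using 0 by simp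
  have "isCont (convolution F D) p" for p
  proof -
    obtain a b where ab: "\<And>x. x \<in> ball p 1 \<Longrightarrow> cball x r \<subseteq> cbox a b"
      using convolution_local_box by blast
    have "continuous_on (ball p 1) (\<lambda>x. integral (cbox a b) (\<lambda>y. F y * D (x - y)))"
      by (rule integral_continuous_on_param, unfold split_beta)
         (intro continuous_intros continuous_on_compose2[OF F] continuous_on_compose2[OF cD]; simp)
    then have "continuous_on (ball p 1) (convolution F D)"
    proof (rule continuous_on_eq)
      fix x assume "x \<in> ball p 1"
      from ab[OF this] show "integral (cbox a b) (\<lambda>y. F y * D (x - y)) = convolution F D x"
        by (intro sym[OF convolution_eq_integral_cbox] 0(2))
    qed
    then show ?thesis by (simp add: continuous_on_eq_continuous_at)
  qed
  then show ?case by (simp add: continuous_at_imp_continuous_on)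
next
  case (Suc k)
  from Suc.prems(1) obtain D' where
    D': "\<And>z. (D has_derivative D' z) (at z)" "\<And>v. Ck_on UNIV k UNIV (\<lambda>z. D' z v)"
    by (rule Ck_on_SucE) auto
  have D'0: "D' z v = 0" if "z \<notin> cball 0 r" for z v
  proof -
    have "((\<lambda>z. 0) has_derivative D' z) (at z)"
      by (rule has_derivative_transform_within_open[OF D'(1), where s="- cball 0 r"])
         (use that Suc.prems(2) in auto)
    then have "D' z = (\<lambda>v. 0)"
      using has_derivative_unique has_derivative_const by blast
    then show ?thesis by simp
  qed
  show ?case
  proof (rule Ck_on_SucI)
    show "(convolution F D has_derivative (\<lambda>v. convolution F (\<lambda>z. D' z v) x)) (at x)" for x
      by (rule has_derivative_convolution[OF F Suc.prems(2) D'(1) Ck_on_imp_continuous_on[OF D'(2)] D'0])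
    show "Ck_on UNIV k UNIV (\<lambda>x. convolution F (\<lambda>z. D' z v) x)" for v
      by (rule Suc.IH[OF D'(2) D'0])
  qed
qed

text \<open>
The properties of integration against a smooth probability density with support in the ball of radius
\<open>r\<close> on which the approximation rests: a normalized positive linear functional on continuous
functions that only sees that ball and turns translates into smooth functions.
\<close>

definition smoothing_average :: "real \<Rightarrow> (('a::euclidean_space \<Rightarrow> real) \<Rightarrow> real) \<Rightarrow> bool" where
  "smoothing_average r A \<longleftrightarrow>
     (\<forall>f g. continuous_on UNIV f \<longrightarrow> continuous_on UNIV g \<longrightarrow>
        (\<forall>z. norm z \<le> r \<longrightarrow> f z \<le> g z) \<longrightarrow> A f \<le> A g) \<and>
     (\<forall>f g u v. continuous_on UNIV f \<longrightarrow> continuous_on UNIV g \<longrightarrow>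
        A (\<lambda>z. u * f z + v * g z) = u * A f + v * A g) \<and>
     (\<forall>c. A (\<lambda>z. c) = c) \<and>
     (\<forall>F n. continuous_on UNIV F \<longrightarrow> Ck_on UNIV n UNIV (\<lambda>x. A (\<lambda>z. F (x - z))))"

lemma
  assumes "smoothing_average r A"
  shows smoothing_average_mono: "\<lbrakk>continuous_on UNIV f; continuous_on UNIV g;
      \<And>z. norm z \<le> r \<Longrightarrow> f z \<le> g z\<rbrakk> \<Longrightarrow> A f \<le> A g"
    and smoothing_average_linear: "\<lbrakk>continuous_on UNIV f; continuous_on UNIV g\<rbrakk> \<Longrightarrow>
      A (\<lambda>z. u * f z + v * g z) = u * A f + v * A g"
    and smoothing_average_const: "A (\<lambda>z. c) = c"
    and smoothing_average_smooth:
      "continuous_on UNIV F \<Longrightarrow> Ck_on UNIV n UNIV (\<lambda>x. A (\<lambda>z. F (x - z)))"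
  using assms unfolding smoothing_average_def by blast+

lemma smoothing_average_exists:
  fixes r :: real
  assumes "r > 0"
  shows "\<exists>A :: ('a::euclidean_space \<Rightarrow> real) \<Rightarrow> real. smoothing_average r A"
proof -
  define D :: "'a \<Rightarrow> real" where "D z = flat_exp 0 (r\<^sup>2 - z \<bullet> z)" for z
  have smD: "Ck_on UNIV k UNIV D" for k
    unfolding D_def by (rule Ck_on_bump)
  then have cD: "continuous_on X D" for X
    using Ck_on_imp_continuous_on continuous_on_subset by blast
  have D0: "D z = 0" if "z \<notin> cball 0 r" for z
  proof -
    have "r\<^sup>2 \<le> (norm z)\<^sup>2" using that assms by (intro power_mono) auto
    then show ?thesis by (simp add: D_def flat_exp_def power2_norm_eq_inner)
  qed
  have Dnn: "D z \<ge> 0" for z by (simp add: D_def flat_exp_def)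
  have "D 0 > 0" using assms by (simp add: D_def flat_exp_def)
  obtain c :: 'a where c: "cball 0 r \<subseteq> cbox (- c) c"
    using bounded_subset_cbox_symmetric bounded_cball by blast
  define Q where "Q = cbox (- c) c"
  define w where "w = integral Q D"
  have "0 \<in> interior (cball (0::'a) r)" using assms by simp
  then have box: "0 \<in> box (- c) c"
    using interior_mono[OF c] by auto
  have "w \<ge> 0"
    unfolding w_def by (intro integral_nonneg) (simp_all add: Q_def integrable_continuous cD Dnn)
  moreover have "w \<noteq> 0"
    unfolding w_def Q_def
    using integral_cbox_eq_0_iff[OF cD, of "-c" c] box \<open>D 0 > 0\<close> Dnn box_subset_cbox
    by (metis empty_iff less_irrefl subsetD)
  ultimately have "w > 0" by simp
  define A where "A f = integral Q (\<lambda>z. f z * D z) / w" for f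
  have int: "(\<lambda>z. f z * D z) integrable_on Q" if "continuous_on UNIV f" for f
    unfolding Q_def by (intro integrable_continuous continuous_intros cD continuous_on_subset[OF that]) auto
  have "smoothing_average r A"
    unfolding smoothing_average_def
  proof (intro conjI allI impI)
    fix f g :: "'a \<Rightarrow> real"
    assume f: "continuous_on UNIV f" and g: "continuous_on UNIV g"
      and le: "\<forall>z. norm z \<le> r \<longrightarrow> f z \<le> g z"
    have "f z * D z \<le> g z * D z" for z
      using le D0[of z] Dnn[of z] by (cases "norm z \<le> r") (auto intro: mult_right_mono)
    then show "A f \<le> A g"
      unfolding A_def using \<open>w > 0\<close> by (intro divide_right_mono integral_le int f g) auto
  next
    fix f g :: "'a \<Rightarrow> real" and u v
    assume f: "continuous_on UNIV f" and g: "continuous_on UNIV g"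
    have "integral Q (\<lambda>z. (u * f z + v * g z) * D z)
        = integral Q (\<lambda>z. u * (f z * D z) + v * (g z * D z))"
      by (simp add: algebra_simps)
    also have "\<dots> = u * integral Q (\<lambda>z. f z * D z) + v * integral Q (\<lambda>z. g z * D z)"
      using int[OF f] int[OF g]
      by (subst integral_add) (auto intro: integrable_on_mult_right)
    finally show "A (\<lambda>z. u * f z + v * g z) = u * A f + v * A g"
      by (simp add: A_def add_divide_distrib)
  next
    show "A (\<lambda>z. k) = k" for k
      using \<open>w > 0\<close> by (simp add: A_def w_def)
  next
    fix F :: "'a \<Rightarrow> real" and k
    assume F: "continuous_on UNIV F"
    have "(\<lambda>x. A (\<lambda>z. F (x - z))) = (\<lambda>x. convolution F D x * (1 / w))"
      using convolution_translate[OF D0 c F cD] by (auto simp: A_def Q_def)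
    moreover have "Ck_on UNIV k UNIV (convolution F D)"
      by (rule Ck_on_convolution[OF F smD]) (rule D0)
    ultimately show "Ck_on UNIV k UNIV (\<lambda>x. A (\<lambda>z. F (x - z)))"
      using Ck_on_mult[OF _ Ck_on_const] by metis
  qed
  then show ?thesis by blast
qed

section \<open>Regularization of convex functions by infimal convolution\<close>

text \<open>
On a translate of any bounded set far enough inside \<open>\<sigma>\<close>, the function grows along \<open>\<sigma>\<close> exactly
as \<open>H\<close> does. If \<open>H\<close> is \<open>- m\<close> on \<open>\<sigma>\<close> with \<open>m\<close> linear, then \<open>f + m\<close> is eventually constant
along \<open>\<sigma>\<close>, locally uniformly.
\<close>

definition asymptotically_additive :: "('a::euclidean_space \<Rightarrow> real) \<Rightarrow> 'a set \<Rightarrow> ('a \<Rightarrow> real) \<Rightarrow> bool" where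
  "asymptotically_additive H \<sigma> f \<longleftrightarrow>
     (\<forall>B. bounded B \<longrightarrow> (\<exists>s\<in>\<sigma>. \<forall>x\<in>B. \<forall>t\<in>\<sigma>. f (x + s + t) = f (x + s) + H t))"

lemma asymptotically_additiveE:
  assumes "asymptotically_additive H \<sigma> f" "bounded B"
  obtains s where "s \<in> \<sigma>" "\<forall>x\<in>B. \<forall>t\<in>\<sigma>. f (x + s + t) = f (x + s) + H t"
  using assms unfolding asymptotically_additive_def by blast

locale sublinear_growth =
  fixes H g :: "'a::euclidean_space \<Rightarrow> real"
  assumes subadditive: "H (x + y) \<le> H x + H y"
    and homogeneous: "0 \<le> t \<Longrightarrow> H (t *\<^sub>R x) = t * H x"
    and convex: "convex_on UNIV g"
    and growth: "g (x + w) \<le> g x + H w"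
begin

lemma H_zero: "H 0 = 0"
  using homogeneous[of 0 0] by simp

lemma H_convex: "convex_on UNIV H"
proof (rule convex_onI)
  fix t :: real and x y
  assume "0 < t" "t < 1"
  then show "H ((1 - t) *\<^sub>R x + t *\<^sub>R y) \<le> (1 - t) * H x + t * H y"
    using subadditive[of "(1 - t) *\<^sub>R x" "t *\<^sub>R y"] by (simp add: homogeneous)
qed simp

lemma H_le_norm:
  obtains L where "L > 0" "\<And>w. H w \<le> L * norm w"
proof -
  have "continuous_on (sphere 0 1) H"
    using convex_on_continuous[OF open_UNIV H_convex] continuous_on_subset by blast
  then have "bounded (H ` sphere 0 1)"
    by (intro compact_imp_bounded compact_continuous_image compact_sphere)
  then obtain L where L: "L > 0" "\<And>u. norm u = 1 \<Longrightarrow> \<bar>H u\<bar> \<le> L"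
    by (auto simp: bounded_pos)
  have "H w \<le> L * norm w" for w
  proof (cases "w = 0")
    case False
    have "H w = norm w * H (w /\<^sub>R norm w)"
      using homogeneous[of "norm w" "w /\<^sub>R norm w"] False by simp
    also have "\<dots> \<le> norm w * L"
      using L(2)[of "w /\<^sub>R norm w"] False by (intro mult_left_mono) auto
    finally show ?thesis by (simp add: mult.commute)
  qed (simp add: H_zero)
  with L that show thesis by blast
qed

text \<open>
With \<open>y\<close> unrestricted the infimum would be \<open>g\<close> itself. Bounding \<open>y\<close> forces the function to
follow \<open>H\<close> far away from the ball, while inside the ball it still equals \<open>g\<close>.
\<close>

definition infconv :: "nat \<Rightarrow> 'a \<Rightarrow> real" where
  "infconv j v = (INF y\<in>cball 0 (real j). g y + H (v - y))"

text \<open>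
This bound keeps the infima finite and puts them above \<open>g\<close>.
\<close>

lemma minorant: "g v \<le> g y + H (v - y)"
  using growth[of y "v - y"] by simp

lemma infconv_le: "norm y \<le> real j \<Longrightarrow> infconv j v \<le> g y + H (v - y)"
  unfolding infconv_def by (rule cINF_lower[OF bdd_belowI2[of _ "g v"]]) (auto simp: minorant)

lemma infconv_greatest:
  "(\<And>y. norm y \<le> real j \<Longrightarrow> c \<le> g y + H (v - y)) \<Longrightarrow> c \<le> infconv j v"
  unfolding infconv_def by (rule cINF_greatest) auto

lemma le_infconv: "g v \<le> infconv j v"
  by (rule infconv_greatest) (rule minorant)

lemma infconv_eq: "norm v \<le> real j \<Longrightarrow> infconv j v = g v"
  using infconv_le[of v j v] le_infconv[of v j] by (simp add: H_zero)

lemma infconv_antimono: "i \<le> j \<Longrightarrow> infconv j v \<le> infconv i v"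
  by (rule infconv_greatest) (auto intro: infconv_le)

lemma infconv_growth: "infconv j (v + w) \<le> infconv j v + H w"
proof -
  have "infconv j (v + w) - H w \<le> g y + H (v - y)" if "norm y \<le> real j" for y
    using infconv_le[OF that, of "v + w"] subadditive[of "v - y" w] by (simp add: algebra_simps)
  then have "infconv j (v + w) - H w \<le> infconv j v"
    by (rule infconv_greatest)
  then show ?thesis by simp
qed

lemma infconv_approx:
  assumes "e > 0"
  obtains y where "norm y \<le> real j" "g y + H (v - y) < infconv j v + e"
proof -
  have "\<not> infconv j v + e \<le> infconv j v" using assms by simp
  then have "\<not> (\<forall>y. norm y \<le> real j \<longrightarrow> infconv j v + e \<le> g y + H (v - y))"
    using infconv_greatest[of j "infconv j v + e" v] by blast
  then show thesis using that by force
qed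

text \<open>
The expression \<open>g y + H (v - y)\<close> is jointly convex in \<open>(v, y)\<close> and the ball is convex, so
near-optimal points for \<open>x\<close> and for \<open>y\<close> combine to a competitor for the point in between.
\<close>

lemma infconv_convex: "convex_on UNIV (infconv j)"
proof (rule convex_onI)
  fix t :: real and x y
  assume t: "0 < t" "t < 1"
  show "infconv j ((1 - t) *\<^sub>R x + t *\<^sub>R y) \<le> (1 - t) * infconv j x + t * infconv j y"
  proof (rule field_le_epsilon)
    fix e :: real assume "e > 0"
    obtain a where a: "norm a \<le> real j" "g a + H (x - a) < infconv j x + e"
      using \<open>e > 0\<close> by (rule infconv_approx)
    obtain b where b: "norm b \<le> real j" "g b + H (y - b) < infconv j y + e"
      using \<open>e > 0\<close> by (rule infconv_approx)
    let ?c = "(1 - t) *\<^sub>R a + t *\<^sub>R b"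
    have "?c \<in> cball 0 (real j)"
      using a b t by (intro convexD_alt) auto
    then have "infconv j ((1 - t) *\<^sub>R x + t *\<^sub>R y) \<le> g ?c + H ((1 - t) *\<^sub>R x + t *\<^sub>R y - ?c)"
      by (intro infconv_le) simp
    also have "(1 - t) *\<^sub>R x + t *\<^sub>R y - ?c = (1 - t) *\<^sub>R (x - a) + t *\<^sub>R (y - b)"
      by (simp add: algebra_simps)
    also have "g ?c + H \<dots> \<le> ((1 - t) * g a + t * g b) + ((1 - t) * H (x - a) + t * H (y - b))"
      using t by (intro add_mono convex_onD[OF convex] convex_onD[OF H_convex]) auto
    also have "\<dots> = (1 - t) * (g a + H (x - a)) + t * (g b + H (y - b))"
      by (simp add: algebra_simps)
    also have "\<dots> \<le> (1 - t) * (infconv j x + e) + t * (infconv j y + e)"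
      using a b t by (intro add_mono[OF mult_left_mono mult_left_mono]) auto
    also have "\<dots> = (1 - t) * infconv j x + t * infconv j y + e"
      by (simp add: algebra_simps)
    finally show "infconv j ((1 - t) *\<^sub>R x + t *\<^sub>R y) \<le> (1 - t) * infconv j x + t * infconv j y + e" .
  qed
qed simp

text \<open>
The arguments \<open>x - y\<close> of \<open>H\<close> remain in a bounded set, so a single shift \<open>s\<close> serves all \<open>y\<close>.
\<close>

lemma infconv_asymptotically_additive:
  assumes "asymptotically_additive H \<sigma> H"
  shows "asymptotically_additive H \<sigma> (infconv j)"
  unfolding asymptotically_additive_def
proof (intro allI impI)
  fix B :: "'a set" assume "bounded B"
  then have "bounded (\<Union>x\<in>B. \<Union>y\<in>cball 0 (real j). {x - y})"
    by (intro bounded_differences bounded_cball)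
  with assms obtain s where s: "s \<in> \<sigma>"
    "\<forall>x\<in>\<Union>x\<in>B. \<Union>y\<in>cball 0 (real j). {x - y}. \<forall>t\<in>\<sigma>. H (x + s + t) = H (x + s) + H t"
    by (rule asymptotically_additiveE)
  have "infconv j (x + s + t) = infconv j (x + s) + H t" if "x \<in> B" "t \<in> \<sigma>" for x t
  proof (rule antisym)
    have "infconv j (x + s) + H t \<le> g y + H (x + s + t - y)" if y: "norm y \<le> real j" for y
    proof -
      have "H (x - y + s + t) = H (x - y + s) + H t"
      proof (rule s(2)[rule_format, OF _ \<open>t \<in> \<sigma>\<close>])
        have "y \<in> cball 0 (real j)" using y by simp
        with \<open>x \<in> B\<close> show "x - y \<in> (\<Union>x\<in>B. \<Union>y\<in>cball 0 (real j). {x - y})" by blast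
      qed
      then show ?thesis
        using infconv_le[OF y, of "x + s"] by (simp add: algebra_simps)
    qed
    then show "infconv j (x + s) + H t \<le> infconv j (x + s + t)"
      by (rule infconv_greatest)
  qed (rule infconv_growth)
  with s(1) show "\<exists>s\<in>\<sigma>. \<forall>x\<in>B. \<forall>t\<in>\<sigma>. infconv j (x + s + t) = infconv j (x + s) + H t"
    by blast
qed

text \<open>
The growth bound makes all \<open>infconv k\<close> Lipschitz with the constant \<open>L\<close> of \<open>H\<close>. Averaging over
radius \<open>2\<^sup>-\<^sup>k / L\<close> thus changes \<open>infconv k\<close> by at most \<open>2\<^sup>-\<^sup>k\<close>.
\<close>

theorem smooth_decreasing_approximation:
  obtains G :: "nat \<Rightarrow> 'a \<Rightarrow> real" where
    "\<And>k. convex_on UNIV (G k)" "\<And>k n. Ck_on UNIV n UNIV (G k)"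
    "\<And>k x. G (Suc k) x \<le> G k x" "\<And>x. (\<lambda>k. G k x) \<longlonglongrightarrow> g x"
    "\<And>k \<sigma>. asymptotically_additive H \<sigma> H \<Longrightarrow> asymptotically_additive H \<sigma> (G k)"
proof -
  obtain L where L: "L > 0" "\<And>w. H w \<le> L * norm w"
    using H_le_norm by blast
  define d :: "nat \<Rightarrow> real" where "d k = (1 / 2) ^ k" for k
  define r where "r k = d k / L" for k
  have d: "d k > 0" "d (Suc k) = d k / 2" for k by (simp_all add: d_def)
  have r: "r k > 0" for k using d L by (simp add: r_def)
  have cF: "continuous_on X (infconv k)" for k X
    using convex_on_continuous[OF open_UNIV infconv_convex] continuous_on_subset by blast
  have cFx: "continuous_on UNIV (\<lambda>z. infconv k (x - z))" for k x
    by (intro continuous_on_compose2[OF cF[where X=UNIV]] continuous_intros) simp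
  have "\<forall>k. \<exists>A :: ('a \<Rightarrow> real) \<Rightarrow> real. smoothing_average (r k) A"
    using smoothing_average_exists[OF r] by blast
  then obtain A :: "nat \<Rightarrow> ('a \<Rightarrow> real) \<Rightarrow> real" where A: "\<And>k. smoothing_average (r k) (A k)"
    by metis
  note mono = smoothing_average_mono[OF A] and linear = smoothing_average_linear[OF A]
    and const = smoothing_average_const[OF A] and smooth = smoothing_average_smooth[OF A]
  define S where "S k x = A k (\<lambda>z. infconv k (x - z))" for k x
  \<comment> \<open>The offset must drop by at least \<open>d k + d (Suc k)\<close>, the sum of two
     consecutive averaging errors; as \<open>d\<close> halves, \<open>3 * d k\<close> drops by exactly that.\<close>
  define G where "G k x = S k x + 3 * d k" for k x
  have close: "infconv k x - d k \<le> S k x" "S k x \<le> infconv k x + d k" for k x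
  proof -
    have "infconv k x - d k \<le> infconv k (x - z)" "infconv k (x - z) \<le> infconv k x + d k"
      if "norm z \<le> r k" for z
    proof -
      have "L * norm z \<le> d k" using that L(1) by (simp add: r_def field_simps)
      then show "infconv k x - d k \<le> infconv k (x - z)" "infconv k (x - z) \<le> infconv k x + d k"
        using infconv_growth[of k "x - z" z] infconv_growth[of k x "- z"] L(2)[of z] L(2)[of "- z"]
        by auto
    qed
    then have "A k (\<lambda>z. infconv k x - d k) \<le> S k x" "S k x \<le> A k (\<lambda>z. infconv k x + d k)"
      unfolding S_def by (auto intro!: mono cFx)
    then show "infconv k x - d k \<le> S k x" "S k x \<le> infconv k x + d k"
      by (simp_all add: const)
  qed
  show thesis
  proof
    show "convex_on UNIV (G k)" for k
    proof (rule convex_onI)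
      fix t :: real and x y :: 'a
      assume t: "0 < t" "t < 1"
      have "S k ((1 - t) *\<^sub>R x + t *\<^sub>R y)
          \<le> A k (\<lambda>z. (1 - t) * infconv k (x - z) + t * infconv k (y - z))"
        unfolding S_def
      proof (rule mono)
        fix z
        have "(1 - t) *\<^sub>R x + t *\<^sub>R y - z = (1 - t) *\<^sub>R (x - z) + t *\<^sub>R (y - z)"
          by (simp add: algebra_simps)
        then show "infconv k ((1 - t) *\<^sub>R x + t *\<^sub>R y - z)
            \<le> (1 - t) * infconv k (x - z) + t * infconv k (y - z)"
          using t convex_onD[OF infconv_convex[of k], of t "x - z" "y - z"] by simp
      qed (intro cFx continuous_intros)+
      also have "\<dots> = (1 - t) * S k x + t * S k y"
        unfolding S_def by (rule linear) (rule cFx)+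
      finally show "G k ((1 - t) *\<^sub>R x + t *\<^sub>R y) \<le> (1 - t) * G k x + t * G k y"
        by (simp add: G_def algebra_simps)
    qed simp
    show "Ck_on UNIV n UNIV (G k)" for k n
      unfolding G_def S_def by (intro Ck_on_add Ck_on_const smooth cF)
    show "G (Suc k) x \<le> G k x" for k x
      using close(2)[of "Suc k" x] close(1)[of k x] infconv_antimono[of k "Suc k" x] d[of k]
      by (simp add: G_def)
    show "(\<lambda>k. G k x) \<longlonglongrightarrow> g x" for x
    proof (rule LIM_zero_cancel, rule Lim_null_comparison)
      obtain K where K: "norm x \<le> real K" using real_arch_simple by blast
      have "norm (G k x - g x) \<le> 4 * d k" if "k \<ge> K" for k
        using infconv_eq[of x k] close[of k x] that d[of k] K by (simp add: G_def)
      then show "\<forall>\<^sub>F k in sequentially. norm (G k x - g x) \<le> 4 * d k"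
        using eventually_sequentially by blast
      have "d \<longlonglongrightarrow> 0" unfolding d_def by (rule LIMSEQ_realpow_zero) auto
      then show "(\<lambda>k. 4 * d k) \<longlonglongrightarrow> 0"
        using tendsto_mult_right_zero by blast
    qed
    fix k \<sigma> assume "asymptotically_additive H \<sigma> H"
    then have F: "asymptotically_additive H \<sigma> (infconv k)"
      by (rule infconv_asymptotically_additive)
    show "asymptotically_additive H \<sigma> (G k)"
      unfolding asymptotically_additive_def
    proof (intro allI impI)
      fix B :: "'a set" assume "bounded B"
      then have "bounded (\<Union>x\<in>B. \<Union>y\<in>cball 0 (r k). {x - y})"
        by (intro bounded_differences bounded_cball)
      with F obtain s where s: "s \<in> \<sigma>"
        "\<forall>x\<in>\<Union>x\<in>B. \<Union>y\<in>cball 0 (r k). {x - y}. \<forall>t\<in>\<sigma>.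
          infconv k (x + s + t) = infconv k (x + s) + H t"
        by (rule asymptotically_additiveE)
      have "S k (x + s + t) = S k (x + s) + H t" if "x \<in> B" "t \<in> \<sigma>" for x t
      proof -
        have eq: "infconv k (x + s + t - z) = 1 * infconv k (x + s - z) + H t * 1"
          if "norm z \<le> r k" for z
        proof -
          have "infconv k (x - z + s + t) = infconv k (x - z + s) + H t"
          proof (rule s(2)[rule_format, OF _ \<open>t \<in> \<sigma>\<close>])
            have "z \<in> cball 0 (r k)" using that by simp
            with \<open>x \<in> B\<close> show "x - z \<in> (\<Union>x\<in>B. \<Union>y\<in>cball 0 (r k). {x - y})" by blast
          qed
          then show ?thesis by (simp add: algebra_simps)
        qed
        have "S k (x + s + t) = A k (\<lambda>z. 1 * infconv k (x + s - z) + H t * 1)"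
          unfolding S_def
          by (intro antisym mono cFx continuous_intros) (simp_all add: eq)
        also have "\<dots> = 1 * S k (x + s) + H t * A k (\<lambda>z. 1)"
          unfolding S_def by (rule linear) (intro cFx continuous_intros)+
        finally show ?thesis by (simp add: const)
      qed
      with s(1) show "\<exists>s\<in>\<sigma>. \<forall>x\<in>B. \<forall>t\<in>\<sigma>. G k (x + s + t) = G k (x + s) + H t"
        unfolding G_def by (intro bexI[of _ s]) auto
    qed
  qed
qed

end

section \<open>Cones and complete fans\<close>

text \<open>
The span of a convex cone consists of the differences of its elements.
\<close>

lemma span_convex_coneE:
  assumes "convex_cone \<sigma>" "u \<in> span \<sigma>"
  obtains s where "s \<in> \<sigma>" "u + s \<in> \<sigma>"
proof -
  note cc = convex_cone_contains_0[OF assms(1)] convex_cone_add[OF assms(1)] convex_cone_scaleR[OF assms(1)]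
  have "\<exists>s\<in>\<sigma>. u + s \<in> \<sigma>"
    using assms(2)
  proof (induction rule: span_induct_alt)
    case base
    then show ?case using cc(1) by force
  next
    case (step c x y)
    then obtain s where s: "s \<in> \<sigma>" "y + s \<in> \<sigma>" by blast
    show ?case
    proof (cases "c \<ge> 0")
      case True
      have "c *\<^sub>R x + (y + s) \<in> \<sigma>" by (rule cc(2)[OF cc(3)[OF True step(1)] s(2)])
      then show ?thesis using s by (intro bexI[of _ s]) (simp_all add: add.assoc)
    next
      case False
      have "(- c) *\<^sub>R x + s \<in> \<sigma>" using step(1) False s(1) by (intro cc(2,3)) auto
      moreover have "c *\<^sub>R x + y + ((- c) *\<^sub>R x + s) = y + s" by simp
      ultimately show ?thesis using s by metis
    qed
  qed
  with that show thesis by blast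
qed

lemma absorbed_along_rel_interior:
  fixes \<sigma> :: "'a::euclidean_space set"
  assumes "convex_cone \<sigma>" "w \<in> rel_interior \<sigma>" "u \<in> span \<sigma>"
  obtains T where "\<And>t. t \<ge> T \<Longrightarrow> u + t *\<^sub>R w \<in> \<sigma>"
proof -
  have aff: "affine hull \<sigma> = span \<sigma>"
    using convex_cone_contains_0[OF assms(1)] by (intro affine_hull_span_0 hull_inc)
  obtain e where e: "e > 0" "ball w e \<inter> span \<sigma> \<subseteq> \<sigma>"
    using assms(2) unfolding mem_rel_interior_ball aff by blast
  have w: "w \<in> span \<sigma>" using assms(2) rel_interior_subset span_superset by blast
  have "u + t *\<^sub>R w \<in> \<sigma>" if t: "t \<ge> norm u / e + 1" for t
  proof -
    have "t > 0" using t e by (smt (verit) divide_nonneg_pos norm_ge_zero)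
    moreover have "norm u < t * e" using t e by (simp add: field_simps)
    ultimately have "norm (u /\<^sub>R t) < e" by (simp add: field_simps)
    then have "w + u /\<^sub>R t \<in> ball w e \<inter> span \<sigma>"
      using w assms(3) by (auto simp: dist_norm intro: span_add span_scale)
    then have "t *\<^sub>R (w + u /\<^sub>R t) \<in> \<sigma>"
      using e \<open>t > 0\<close> by (intro convex_cone_scaleR[OF assms(1)]) auto
    then show ?thesis using \<open>t > 0\<close> by (simp add: algebra_simps)
  qed
  with that show thesis .
qed

lemma zero_face_of_strictly_convex_cone:
  assumes "convex_cone \<sigma>" "strictly_convex_cone \<sigma>"
  shows "{0} face_of \<sigma>"
proof -
  have *: "a = 0 \<and> b = 0" if ab: "a \<in> \<sigma>" "b \<in> \<sigma>" and seg: "0 \<in> open_segment a b" for a b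
  proof -
    obtain u where u: "0 < u" "u < 1" "0 = (1 - u) *\<^sub>R a + u *\<^sub>R b"
      using seg by (auto simp: in_segment)
    then have "- ((1 - u) *\<^sub>R a) = u *\<^sub>R b" by (metis add.inverse_unique)
    then have "- ((1 - u) *\<^sub>R a) \<in> \<sigma>" "(1 - u) *\<^sub>R a \<in> \<sigma>"
      using ab u by (auto intro!: convex_cone_scaleR[OF assms(1)])
    then have "(1 - u) *\<^sub>R a = 0"
      using assms(2) unfolding strictly_convex_cone_def by blast
    with u show ?thesis by auto
  qed
  show ?thesis
    unfolding face_of_def using * convex_cone_contains_0[OF assms(1)] by auto
qed

locale complete_rational_fan =
  fixes N :: "'a::euclidean_space set" and \<Sigma> :: "'a set set"
  assumes complete: "complete_fan N \<Sigma>"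
begin

lemma fan: "fan N \<Sigma>" and Union_fan: "\<Union>\<Sigma> = span N"
  using complete by (auto simp: complete_fan_def)

lemma finite_fan: "finite \<Sigma>"
  using fan by (simp add: fan_def)

lemma cone:
  assumes "\<sigma> \<in> \<Sigma>"
  shows "convex_cone \<sigma>" "closed \<sigma>" "polyhedron \<sigma>" "strictly_convex_cone \<sigma>" "\<sigma> \<subseteq> span N"
proof -
  have "rational_cone N \<sigma>" using fan assms by (simp add: fan_def)
  then obtain T where T: "finite T" "\<sigma> = convex_cone hull T"
    unfolding rational_cone_def by blast
  show "convex_cone \<sigma>" unfolding T by (rule convex_cone_convex_cone_hull)
  show "polyhedron \<sigma>" unfolding T using T(1) by (rule polyhedron_convex_cone_hull)
  then show "closed \<sigma>" by (rule polyhedron_imp_closed)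
  show "strictly_convex_cone \<sigma>" using fan assms by (simp add: fan_def)
  show "\<sigma> \<subseteq> span N" using Union_fan assms by blast
qed

lemma convex_of_cone: "\<sigma> \<in> \<Sigma> \<Longrightarrow> convex \<sigma>"
  using cone(1) by (simp add: convex_cone_def)

lemma face_in_fan: "\<sigma> \<in> \<Sigma> \<Longrightarrow> \<tau> face_of \<sigma> \<Longrightarrow> \<tau> \<noteq> {} \<Longrightarrow> \<tau> \<in> \<Sigma>"
  using fan unfolding fan_def by blast

lemma zero_cone: "\<sigma> \<in> \<Sigma> \<Longrightarrow> {0} face_of \<sigma> \<and> {0} \<in> \<Sigma>"
  using zero_face_of_strictly_convex_cone cone(1,4) face_in_fan by blast

text \<open>
Take a minimal cone that contains \<open>v\<close>; a point on its relative boundary would lie in a facet,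
which is a smaller cone of the fan.
\<close>

lemma in_rel_interior_of_cone:
  assumes "v \<in> span N"
  obtains \<sigma> where "\<sigma> \<in> \<Sigma>" "v \<in> rel_interior \<sigma>"
proof -
  let ?A = "{\<sigma>\<in>\<Sigma>. v \<in> \<sigma>}"
  have "finite ?A" "?A \<noteq> {}"
    using finite_fan Union_fan assms by auto
  from finite_has_minimal[OF this] obtain \<sigma>
    where \<sigma>: "\<sigma> \<in> \<Sigma>" "v \<in> \<sigma>" and min: "\<forall>\<tau>\<in>?A. \<tau> \<subseteq> \<sigma> \<longrightarrow> \<sigma> = \<tau>"
    by auto
  have "v \<in> rel_interior \<sigma>"
  proof (rule ccontr)
    assume "v \<notin> rel_interior \<sigma>"
    then obtain F where F: "F facet_of \<sigma>" "v \<in> F"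
      using rel_boundary_of_polyhedron[OF cone(3)[OF \<sigma>(1)]] \<sigma>(2) by blast
    then have "F face_of \<sigma>" "F \<subseteq> \<sigma>" by (auto simp: facet_of_imp_face_of facet_of_imp_subset)
    with F \<sigma> have "\<sigma> = F"
      using face_in_fan[OF \<sigma>(1), of F] by (intro min[rule_format]) auto
    with F show False by simp
  qed
  with \<sigma> that show thesis by blast
qed

text \<open>
Cones that miss \<open>s\<close> are closed and finite in number, so they miss a ball about \<open>s\<close>; rescaling,
\<open>x + T s\<close> avoids them for large \<open>T\<close>. By completeness \<open>x + T s\<close> lies in some cone \<open>\<tau>\<close>, which
then contains \<open>s\<close>. As \<open>\<sigma> \<inter> \<tau>\<close> is a face of \<open>\<sigma>\<close> that meets the relative interior, it is all of \<open>\<sigma>\<close>.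
\<close>

lemma star_of_cone_absorbs_bounded:
  assumes \<sigma>: "\<sigma> \<in> \<Sigma>" and s: "s \<in> rel_interior \<sigma>" and "bounded B"
  obtains T where "T \<ge> 0" "\<And>x. x \<in> B \<Longrightarrow> x \<in> span N \<Longrightarrow> \<exists>\<tau>\<in>\<Sigma>. \<sigma> \<subseteq> \<tau> \<and> x + T *\<^sub>R s \<in> \<tau>"
proof -
  have "closed (\<Union>{\<tau>\<in>\<Sigma>. s \<notin> \<tau>})"
    using finite_fan cone(2) by (intro closed_Union) auto
  then have "open (- \<Union>{\<tau>\<in>\<Sigma>. s \<notin> \<tau>})" by auto
  then obtain e where e: "e > 0" "ball s e \<subseteq> - \<Union>{\<tau>\<in>\<Sigma>. s \<notin> \<tau>}"
    by (rule openE) auto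
  obtain M where M: "M > 0" "\<And>x. x \<in> B \<Longrightarrow> norm x \<le> M"
    using \<open>bounded B\<close> by (auto simp: bounded_pos)
  define T where "T = M / e + 1"
  have T: "T > 0" "M < T * e" using M e by (simp_all add: T_def field_simps add_pos_pos)
  have sN: "s \<in> span N" using s rel_interior_subset cone(5)[OF \<sigma>] by blast
  have "\<exists>\<tau>\<in>\<Sigma>. \<sigma> \<subseteq> \<tau> \<and> x + T *\<^sub>R s \<in> \<tau>" if x: "x \<in> B" "x \<in> span N" for x
  proof -
    have "x + T *\<^sub>R s \<in> span N" using x sN by (intro span_add span_scale)
    then obtain \<tau> where \<tau>: "\<tau> \<in> \<Sigma>" "x + T *\<^sub>R s \<in> \<tau>"
      using Union_fan by blast
    have "s \<in> \<tau>"
    proof (rule ccontr)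
      assume "s \<notin> \<tau>"
      have "(1 / T) *\<^sub>R (x + T *\<^sub>R s) \<in> \<tau>"
        using \<tau> T by (intro convex_cone_scaleR[OF cone(1)]) auto
      then have "s + x /\<^sub>R T \<in> \<tau>"
        using T by (simp add: algebra_simps inverse_eq_divide)
      moreover have "norm x / T < e"
        using M(2)[OF x(1)] T by (simp add: field_simps)
      then have "s + x /\<^sub>R T \<in> ball s e"
        using T by (simp add: dist_norm field_simps)
      ultimately show False using e(2) \<tau>(1) \<open>s \<notin> \<tau>\<close> by blast
    qed
    have "(\<sigma> \<inter> \<tau>) face_of \<sigma>" using fan \<sigma> \<tau> unfolding fan_def by blast
    then have "\<sigma> \<subseteq> \<sigma> \<inter> \<tau>"
      by (rule subset_of_face_of) (use s \<open>s \<in> \<tau>\<close> rel_interior_subset in auto)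
    then show ?thesis using \<tau> by blast
  qed
  with T(1) show thesis by (intro that[of T]) auto
qed

lemma piecewise_linear_scale:
  assumes "piecewise_linear_integral N \<Sigma> \<Psi>" "v \<in> span N" "0 \<le> t"
  shows "\<Psi> (t *\<^sub>R v) = t * \<Psi> v"
proof -
  obtain \<sigma> where \<sigma>: "\<sigma> \<in> \<Sigma>" "v \<in> \<sigma>" using Union_fan assms(2) by blast
  then obtain m where m: "m \<in> dual_lattice N" "\<forall>v\<in>\<sigma>. \<Psi> v = m v"
    using assms(1) unfolding piecewise_linear_integral_def by blast
  have "t *\<^sub>R v \<in> \<sigma>" using convex_cone_scaleR[OF cone(1)] \<sigma> assms(3) by blast
  with m \<sigma>(2) show ?thesis by (simp add: dual_lattice_def linear_scale)
qed

text \<open>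
Deep inside \<open>\<sigma>\<close> one stays in cones that contain \<open>\<sigma>\<close>, where \<open>\<Psi>\<close> is linear. The projection \<open>p\<close>
onto \<open>N\<^sub>\<real>\<close> turns \<open>\<Psi>\<close> into a function on the ambient space, where the regularization takes place.
\<close>

lemma asymptotically_additive_support:
  assumes pl: "piecewise_linear_integral N \<Sigma> \<Psi>" and \<sigma>: "\<sigma> \<in> \<Sigma>"
    and p: "linear p" "range p \<subseteq> span N" "\<And>v. v \<in> span N \<Longrightarrow> p v = v"
  shows "asymptotically_additive (\<lambda>v. - \<Psi> (p v)) \<sigma> (\<lambda>v. - \<Psi> (p v))"
  unfolding asymptotically_additive_def
proof (intro allI impI)
  fix B :: "'a set" assume "bounded B"
  then have B: "bounded (p ` B)"
    by (intro bounded_linear_image linear_conv_bounded_linear[THEN iffD1] p(1))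
  obtain w where w: "w \<in> rel_interior \<sigma>"
    using rel_interior_eq_empty[OF convex_of_cone[OF \<sigma>]] convex_cone_contains_0[OF cone(1)[OF \<sigma>]] by blast
  obtain T where T: "T \<ge> 0"
    "\<And>x. x \<in> p ` B \<Longrightarrow> x \<in> span N \<Longrightarrow> \<exists>\<tau>\<in>\<Sigma>. \<sigma> \<subseteq> \<tau> \<and> x + T *\<^sub>R w \<in> \<tau>"
    using star_of_cone_absorbs_bounded[OF \<sigma> w B] by blast
  have Tw: "T *\<^sub>R w \<in> \<sigma>"
    using w rel_interior_subset T(1) by (intro convex_cone_scaleR[OF cone(1)[OF \<sigma>]]) auto
  have pid: "p v = v" if "v \<in> \<sigma>" for v
    using that cone(5)[OF \<sigma>] p(3) by blast
  have "- \<Psi> (p (x + T *\<^sub>R w + t)) = - \<Psi> (p (x + T *\<^sub>R w)) + - \<Psi> (p t)"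
    if x: "x \<in> B" and t: "t \<in> \<sigma>" for x t
  proof -
    obtain \<tau> where \<tau>: "\<tau> \<in> \<Sigma>" "\<sigma> \<subseteq> \<tau>" "p x + T *\<^sub>R w \<in> \<tau>"
      using T(2)[of "p x"] x p(2) by blast
    then obtain m where m: "m \<in> dual_lattice N" "\<forall>v\<in>\<tau>. \<Psi> v = m v"
      using pl unfolding piecewise_linear_integral_def by blast
    have "p x + T *\<^sub>R w + t \<in> \<tau>"
      using convex_cone_add[OF cone(1)[OF \<tau>(1)] \<tau>(3)] t \<tau>(2) by blast
    then show ?thesis
      using m \<tau> t pid[OF Tw] pid[OF t]
      by (auto simp: linear_add[OF p(1)] dual_lattice_def linear_add)
  qed
  with Tw show "\<exists>s\<in>\<sigma>. \<forall>x\<in>B. \<forall>t\<in>\<sigma>. - \<Psi> (p (x + s + t)) = - \<Psi> (p (x + s)) + - \<Psi> (p t)"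
    by blast
qed

end

section \<open>Growth of convex singular Green functions\<close>

context complete_rational_fan
begin

text \<open>
A ray in a direction \<open>w\<close> of the relative interior of \<open>\<sigma>\<close> converges in \<open>N\<^sub>\<Sigma>\<close> to the image of its
starting point in the stratum of \<open>\<sigma>\<close>. It is enough to check this on the generating sets, where it
holds because \<open>u + t w\<close> enters \<open>\<sigma>\<close> for every \<open>u\<close> in its span.
\<close>

lemma ray_tends_to_stratum:
  assumes \<sigma>: "\<sigma> \<in> \<Sigma>" and w: "w \<in> rel_interior \<sigma>"
    and W: "openin (N_Sigma N \<Sigma>) W" "quot_proj \<sigma> a \<in> W"
  obtains T where "\<And>t. t \<ge> T \<Longrightarrow> embed_NR (a + t *\<^sub>R w) \<in> W"
proof -
  have "\<exists>T. \<forall>t\<ge>T. embed_NR (a + t *\<^sub>R w) \<in> W"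
    using openin_topology_generated_by[OF W(1)[unfolded N_Sigma_def]] W(2)
  proof induction
    case Empty
    then show ?case by simp
  next
    case (Int A B)
    then obtain T T' where "\<forall>t\<ge>T. embed_NR (a + t *\<^sub>R w) \<in> A" "\<forall>t\<ge>T'. embed_NR (a + t *\<^sub>R w) \<in> B"
      by blast
    then show ?case by (intro exI[of _ "max T T'"]) auto
  next
    case (UN K)
    then show ?case by blast
  next
    case (Basis A)
    then obtain \<sigma>' \<Omega> where A: "A = basic_nhd \<Sigma> \<sigma>' \<Omega>" and \<sigma>': "\<sigma>' \<in> \<Sigma>"
      by blast
    from Basis(2) obtain x s where face: "\<sigma> face_of \<sigma>'" and x: "x \<in> \<Omega>" and s: "s \<in> \<sigma>'"
      and eq: "{a + w | w. w \<in> span \<sigma>} = {x + s + w | w. w \<in> span \<sigma>}"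
      unfolding A basic_nhd_def quot_proj_def by auto
    have "a \<in> {a + w | w. w \<in> span \<sigma>}" using span_zero by force
    then obtain u where u: "u \<in> span \<sigma>" "a = x + s + u" unfolding eq by blast
    obtain T where T: "\<And>t. t \<ge> T \<Longrightarrow> u + t *\<^sub>R w \<in> \<sigma>"
      using absorbed_along_rel_interior[OF cone(1)[OF \<sigma>] w u(1)] by blast
    have "embed_NR (a + t *\<^sub>R w) \<in> A" if "t \<ge> T" for t
    proof -
      have "u + t *\<^sub>R w \<in> \<sigma>'" using T[OF that] face_of_imp_subset[OF face] by blast
      then have "s + (u + t *\<^sub>R w) \<in> \<sigma>'" by (rule convex_cone_add[OF cone(1)[OF \<sigma>'] s])
      moreover have "a + t *\<^sub>R w = x + (s + (u + t *\<^sub>R w))" by (simp add: u(2))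
      ultimately have "a + t *\<^sub>R w \<in> {x + s | x s. x \<in> \<Omega> \<and> s \<in> \<sigma>'}" using x by blast
      then show ?thesis unfolding A basic_nhd_def using zero_cone[OF \<sigma>'] by blast
    qed
    then show ?case by blast
  qed
  with that show thesis by blast
qed

text \<open>
Let \<open>w\<close> be in the relative interior of \<open>\<sigma>\<close>. The ray from \<open>a\<close> in direction \<open>w\<close> converges to a
point of the stratum of \<open>\<sigma>\<close>, where the extension of \<open>g + m\<close> has a value below \<open>\<infinity>\<close>. Hence
\<open>g + m\<close> is bounded above on the far part of the ray, and a convex function that is bounded above on
a half-line is nonincreasing there. Comparing parameters 0 and 1 gives the claim.
\<close>

lemma singular_Green_function_growth:
  assumes pl: "piecewise_linear_integral N \<Sigma> \<Psi>" and g: "convex_on (span N) g"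
    and Green: "singular_Green_function N \<Sigma> \<Psi> g"
    and a: "a \<in> span N" and w: "w \<in> span N"
  shows "g (a + w) \<le> g a - \<Psi> w"
proof -
  obtain \<sigma> where \<sigma>: "\<sigma> \<in> \<Sigma>" "w \<in> rel_interior \<sigma>"
    using in_rel_interior_of_cone[OF w] by blast
  obtain m where m: "m \<in> dual_lattice N" "\<forall>v\<in>\<sigma>. \<Psi> v = m v"
    using pl \<sigma>(1) unfolding piecewise_linear_integral_def by blast
  have lin: "linear m" using m(1) by (simp add: dual_lattice_def)
  have "\<exists>U h. openin (N_Sigma N \<Sigma>) U \<and> stratum N \<sigma> \<subseteq> U \<and>
           continuous_map (subtopology (N_Sigma N \<Sigma>) U) (top_of_set {x::ereal. x \<noteq> \<infinity>}) h \<and>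
           (\<forall>v\<in>span N. embed_NR v \<in> U \<longrightarrow> h (embed_NR v) = ereal (g v + m v))"
    using Green \<sigma>(1) m unfolding singular_Green_function_def by simp
  then obtain U h where U: "openin (N_Sigma N \<Sigma>) U" "stratum N \<sigma> \<subseteq> U"
    and h: "continuous_map (subtopology (N_Sigma N \<Sigma>) U) (top_of_set {x::ereal. x \<noteq> \<infinity>}) h"
    and hg: "\<And>v. v \<in> span N \<Longrightarrow> embed_NR v \<in> U \<Longrightarrow> h (embed_NR v) = ereal (g v + m v)"
    by blast
  let ?p = "quot_proj \<sigma> a"
  let ?X = "subtopology (N_Sigma N \<Sigma>) U"
  have top: "topspace ?X = U"
    using openin_subset[OF U(1)] by (simp add: topspace_subtopology Int_absorb1)
  have pU: "?p \<in> U" using U(2) a by (auto simp: stratum_def)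
  have "h ?p \<noteq> \<infinity>"
    using continuous_map_image_subset_topspace[OF h] pU unfolding top by auto
  then obtain C where C: "h ?p < ereal C"
    using ereal_dense2[of "h ?p" \<infinity>] by (auto simp: less_top[symmetric] top_ereal_def)
  have "openin (top_of_set {x::ereal. x \<noteq> \<infinity>}) ({x. x \<noteq> \<infinity>} \<inter> {..<ereal C})"
    by (simp add: openin_open_Int)
  from openin_continuous_map_preimage[OF h this]
  have "openin ?X {y \<in> U. h y \<in> {x. x \<noteq> \<infinity>} \<inter> {..<ereal C}}"
    unfolding top .
  then have W: "openin (N_Sigma N \<Sigma>) {y \<in> U. h y \<in> {x. x \<noteq> \<infinity>} \<inter> {..<ereal C}}"
    using openin_trans_full U(1) by blast
  have pW: "?p \<in> {y \<in> U. h y \<in> {x. x \<noteq> \<infinity>} \<inter> {..<ereal C}}"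
    using pU C \<open>h ?p \<noteq> \<infinity>\<close> by simp
  obtain T where T: "\<And>t. t \<ge> T \<Longrightarrow> embed_NR (a + t *\<^sub>R w) \<in> {y \<in> U. h y \<in> {x. x \<noteq> \<infinity>} \<inter> {..<ereal C}}"
    using ray_tends_to_stratum[OF \<sigma> W pW] by blast
  have bound: "g (a + t *\<^sub>R w) \<le> C - m a - t * m w" if "t \<ge> T" for t
  proof -
    have "a + t *\<^sub>R w \<in> span N" using a w by (intro span_add span_scale)
    with T[OF that] hg have "g (a + t *\<^sub>R w) + m (a + t *\<^sub>R w) < C" by auto
    then show ?thesis by (simp add: linear_add[OF lin] linear_scale[OF lin])
  qed
  \<comment> \<open>The point \<open>a + w\<close> lies between \<open>a\<close> and \<open>a + t w\<close>; the right-hand side does not depend on \<open>t\<close>.\<close>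
  have slope: "t * (g (a + w) + m w - g a) \<le> C - m a - g a" if "t \<ge> T" "t > 1" for t
  proof -
    have "(1 - 1 / t) *\<^sub>R a + (1 / t) *\<^sub>R (a + t *\<^sub>R w) = a + w"
      using that by (simp add: algebra_simps)
    moreover have "g ((1 - 1 / t) *\<^sub>R a + (1 / t) *\<^sub>R (a + t *\<^sub>R w))
        \<le> (1 - 1 / t) * g a + 1 / t * g (a + t *\<^sub>R w)"
      using that a w by (intro convex_onD[OF g]) (auto intro: span_add span_scale)
    ultimately have "g (a + w) \<le> (1 - 1 / t) * g a + 1 / t * g (a + t *\<^sub>R w)"
      by simp
    then have "t * g (a + w) \<le> (t - 1) * g a + g (a + t *\<^sub>R w)"
      using that by (simp add: field_simps)
    then show ?thesis using bound[OF that(1)] by (simp add: algebra_simps)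
  qed
  have "g (a + w) + m w - g a \<le> 0"
  proof (rule ccontr)
    assume pos: "\<not> g (a + w) + m w - g a \<le> 0"
    then obtain n where n: "C - m a - g a < real n * (g (a + w) + m w - g a)"
      using reals_Archimedean3[of "g (a + w) + m w - g a"] by auto
    define t where "t = max (real n) (max T 2)"
    have "real n * (g (a + w) + m w - g a) \<le> t * (g (a + w) + m w - g a)"
      using pos by (intro mult_right_mono) (auto simp: t_def)
    moreover have "T \<le> t" "1 < t" by (auto simp: t_def)
    ultimately show False using n slope[of t] by linarith
  qed
  moreover have "\<Psi> w = m w" using m(2) \<sigma>(2) rel_interior_subset by blast
  ultimately show ?thesis by simp
qed

end

section \<open>Extending smooth functions across the boundary strata\<close>

text \<open>
Here \<open>q v\<close> is the eventual value of \<open>f\<close> on \<open>v + \<sigma>\<close>. Near each point a single shift \<open>s\<close>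
reaches this value, so \<open>q\<close> is locally a translate of \<open>f\<close> and inherits its smoothness.
\<close>

lemma limit_along_cone:
  fixes f :: "'a::euclidean_space \<Rightarrow> real"
  assumes \<sigma>: "convex_cone \<sigma>"
    and additive: "asymptotically_additive (\<lambda>s. 0) \<sigma> f"
    and smooth: "\<And>n. Ck_on UNIV n UNIV f"
  obtains q where "\<And>n. Ck_on UNIV n UNIV q"
    and "\<And>v u. u \<in> span \<sigma> \<Longrightarrow> q (v + u) = q v"
    and "\<And>v. (\<And>s. s \<in> \<sigma> \<Longrightarrow> f (v + s) = f v) \<Longrightarrow> q v = f v"
proof -
  define stable where "stable v s \<longleftrightarrow> s \<in> \<sigma> \<and> (\<forall>t\<in>\<sigma>. f (v + s + t) = f (v + s))" for v s
  have ex: "\<exists>s. \<forall>x\<in>B. stable x s" if "bounded B" for B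
    using additive that unfolding asymptotically_additive_def stable_def by (auto; metis)
  \<comment> \<open>Both values equal the one at \<open>v + s + s'\<close>.\<close>
  have unique: "f (v + s) = f (v + s')" if "stable v s" "stable v s'" for v s s'
  proof -
    have "f (v + s + s') = f (v + s)" "f (v + s' + s) = f (v + s')"
      using that unfolding stable_def by blast+
    then show ?thesis by (simp add: add.commute add.left_commute)
  qed
  define q where "q v = f (v + (SOME s. stable v s))" for v
  have q: "q v = f (v + s)" if "stable v s" for v s
    unfolding q_def using unique someI[of "stable v", OF that] that by blast
  have q_cone: "q (v + u) = q v" if "u \<in> \<sigma>" for v u
  proof -
    obtain s where s: "stable v s" "stable (v + u) s"
      using ex[of "{v, v + u}"] by auto
    have "f (v + u + s) = f (v + s)"
      using s(1) that unfolding stable_def by (metis add.assoc add.commute)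
    then show ?thesis using q[OF s(1)] q[OF s(2)] by simp
  qed
  show thesis
  proof
    show "Ck_on UNIV n UNIV q" for n
    proof (rule Ck_on_glue)
      fix x :: 'a
      obtain s where s: "\<forall>y\<in>ball x 1. stable y s"
        using ex[OF bounded_ball] by blast
      show "\<exists>T f. open T \<and> x \<in> T \<and> Ck_on UNIV n UNIV f \<and> (\<forall>y\<in>T. f y = q y)"
        using q[OF s[rule_format]] Ck_on_translate[OF smooth, of n s]
        by (intro exI[of _ "ball x 1"] exI[of _ "\<lambda>y. f (y + s)"]) simp
    qed
    show "q (v + u) = q v" if u: "u \<in> span \<sigma>" for v u
    proof -
      obtain s where s: "s \<in> \<sigma>" "u + s \<in> \<sigma>"
        using span_convex_coneE[OF \<sigma> u] by blast
      have "q (v + u) = q (v + u + s)" using q_cone[OF s(1)] by simp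
      also have "\<dots> = q v" using q_cone[OF s(2)] by (simp add: add.assoc)
      finally show ?thesis .
    qed
    show "q v = f v" if "\<And>s. s \<in> \<sigma> \<Longrightarrow> f (v + s) = f v" for v
    proof -
      have "stable v 0" using that convex_cone_contains_0[OF \<sigma>] by (simp add: stable_def)
      from q[OF this] show ?thesis by simp
    qed
  qed
qed

lemma quot_proj_eq_iff:
  "quot_proj \<sigma> v = quot_proj \<tau> w \<longleftrightarrow> \<sigma> = \<tau> \<and> v - w \<in> span \<tau>"
proof -
  have "{v + u |u. u \<in> span \<tau>} = {w + u |u. u \<in> span \<tau>} \<longleftrightarrow> v - w \<in> span \<tau>"
  proof
    assume eq: "{v + u |u. u \<in> span \<tau>} = {w + u |u. u \<in> span \<tau>}"
    have "v \<in> {v + u |u. u \<in> span \<tau>}" using span_zero by force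
    then show "v - w \<in> span \<tau>" unfolding eq by auto
  next
    assume d: "v - w \<in> span \<tau>"
    show "{v + u |u. u \<in> span \<tau>} = {w + u |u. u \<in> span \<tau>}"
    proof (intro equalityI subsetI)
      fix x assume "x \<in> {v + u |u. u \<in> span \<tau>}"
      then obtain u where "u \<in> span \<tau>" "x = w + ((v - w) + u)" by auto
      then show "x \<in> {w + u |u. u \<in> span \<tau>}" using span_add[OF d] by blast
    next
      fix x assume "x \<in> {w + u |u. u \<in> span \<tau>}"
      then obtain u where "u \<in> span \<tau>" "x = v + (u - (v - w))" by auto
      then show "x \<in> {v + u |u. u \<in> span \<tau>}" using span_diff[OF _ d] by blast
    qed
  qed
  then show ?thesis unfolding quot_proj_def by auto
qed

lemma strata_proj_quot_proj:
  assumes "span \<tau> \<subseteq> span \<sigma>"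
  shows "strata_proj \<sigma> (quot_proj \<tau> v) = quot_proj \<sigma> v"
proof -
  have "{a + w |a w. a \<in> {v + w |w. w \<in> span \<tau>} \<and> w \<in> span \<sigma>} = {v + w |w. w \<in> span \<sigma>}"
  proof (intro equalityI subsetI)
    fix x assume "x \<in> {a + w |a w. a \<in> {v + w |w. w \<in> span \<tau>} \<and> w \<in> span \<sigma>}"
    then obtain b w where bw: "b \<in> span \<tau>" "w \<in> span \<sigma>" "x = v + (b + w)"
      by (auto simp: add.assoc)
    then have "b + w \<in> span \<sigma>" using assms by (intro span_add) auto
    with bw show "x \<in> {v + w |w. w \<in> span \<sigma>}" by blast
  next
    fix x assume "x \<in> {v + w |w. w \<in> span \<sigma>}"
    then obtain w where "w \<in> span \<sigma>" "x = (v + 0) + w" by auto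
    then show "x \<in> {a + w |a w. a \<in> {v + w |w. w \<in> span \<tau>} \<and> w \<in> span \<sigma>}"
      using span_zero[of \<tau>] by blast
  qed
  then show ?thesis by (simp add: strata_proj_def quot_proj_def)
qed

text \<open>
Let \<open>q\<close> be the eventual value of \<open>f + m\<close> along \<open>\<sigma>\<close>. It is invariant under \<open>span \<sigma>\<close> and therefore
descends to every stratum of a face \<open>\<tau>\<close> of \<open>\<sigma>\<close>, compatibly with the projections between them. The
neighbourhood \<open>U\<close> consists of those basic neighbourhoods on which \<open>f + m\<close> has already reached \<open>q\<close>.
\<close>

lemma (in complete_rational_fan) smooth_Green_functionI:
  assumes additive: "\<And>\<sigma>. \<sigma> \<in> \<Sigma> \<Longrightarrow> asymptotically_additive (\<lambda>v. - \<Psi> v) \<sigma> f"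
    and smooth: "\<And>n. Ck_on UNIV n UNIV f"
  shows "smooth_Green_function N \<Sigma> \<Psi> f"
  unfolding smooth_Green_function_def
proof (intro ballI impI)
  fix \<sigma> m
  assume \<sigma>: "\<sigma> \<in> \<Sigma>" and m: "m \<in> dual_lattice N" and \<Psi>: "\<forall>v\<in>\<sigma>. \<Psi> v = m v"
  have lin: "linear m" using m by (simp add: dual_lattice_def)
  define F where "F v = f v + m v" for v
  have F_add: "asymptotically_additive (\<lambda>s. 0) \<sigma> F"
    unfolding asymptotically_additive_def
  proof (intro allI impI)
    fix B :: "'a set" assume "bounded B"
    with additive[OF \<sigma>] obtain s where s: "s \<in> \<sigma>"
      "\<forall>x\<in>B. \<forall>t\<in>\<sigma>. f (x + s + t) = f (x + s) + - \<Psi> t"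
      by (rule asymptotically_additiveE)
    then show "\<exists>s\<in>\<sigma>. \<forall>x\<in>B. \<forall>t\<in>\<sigma>. F (x + s + t) = F (x + s) + 0"
      using \<Psi> by (intro bexI[of _ s]) (simp_all add: F_def linear_add[OF lin])
  qed
  have "Ck_on UNIV n UNIV F" for n
    unfolding F_def by (intro Ck_on_add smooth Ck_on_linear linear_conv_bounded_linear[THEN iffD1] lin)
  then obtain q where q: "\<And>n. Ck_on UNIV n UNIV q"
    and q_span: "\<And>v u. u \<in> span \<sigma> \<Longrightarrow> q (v + u) = q v"
    and q_eq: "\<And>v. (\<And>s. s \<in> \<sigma> \<Longrightarrow> F (v + s) = F v) \<Longrightarrow> q v = F v"
    using limit_along_cone[OF cone(1)[OF \<sigma>] F_add] by blast
  define \<O> where "\<O> = {\<Omega>. openin (top_of_set (span N)) \<Omega> \<and> convex \<Omega> \<and> bounded \<Omega> \<and>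
      (\<forall>x\<in>\<Omega>. \<forall>s\<in>\<sigma>. F (x + s) = F x)}"
  define U where "U = (\<Union>\<Omega>\<in>\<O>. basic_nhd \<Sigma> \<sigma> \<Omega>)"
  \<comment> \<open>The representatives in \<open>N\<^sub>\<real>\<close> of the points of \<open>U\<close>.\<close>
  define R where "R = {v. \<exists>\<Omega>\<in>\<O>. v \<in> {x + s | x s. x \<in> \<Omega> \<and> s \<in> \<sigma>}}"
  define h where "h y = q (SOME v. v \<in> snd y)" for y :: "'a set \<times> 'a set"
  have U_iff: "y \<in> U \<longleftrightarrow> (\<exists>\<tau> v. y = quot_proj \<tau> v \<and> \<tau> \<in> \<Sigma> \<and> \<tau> face_of \<sigma> \<and> v \<in> R)" for y
    unfolding U_def R_def basic_nhd_def by blast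
  have R_span: "v \<in> span N" if vR: "v \<in> R" for v
  proof -
    obtain \<Omega> x s where "\<Omega> \<in> \<O>" "x \<in> \<Omega>" "s \<in> \<sigma>" "v = x + s"
      using vR unfolding R_def by blast
    then show ?thesis
      using cone(5)[OF \<sigma>] openin_imp_subset[of _ "span N"] by (auto simp: \<O>_def intro!: span_add)
  qed
  have R_eq: "q v = F v" if vR: "v \<in> R" for v
  proof -
    obtain \<Omega> x s where v: "\<Omega> \<in> \<O>" "x \<in> \<Omega>" "s \<in> \<sigma>" "v = x + s"
      using vR unfolding R_def by blast
    have c: "F (x + t) = F x" if "t \<in> \<sigma>" for t
      using v that by (simp add: \<O>_def)
    have "F (v + t) = F v" if "t \<in> \<sigma>" for t
      using c[OF convex_cone_add[OF cone(1)[OF \<sigma>] v(3) that]] c[OF v(3)] v(4) by (simp add: add.assoc)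
    then show ?thesis by (rule q_eq)
  qed
  have h: "h (quot_proj \<tau> v) = q v" if "\<tau> face_of \<sigma>" for \<tau> v
  proof -
    have "v + 0 \<in> snd (quot_proj \<tau> v)"
      unfolding quot_proj_def using span_zero by (simp only: snd_conv) blast
    then have "(SOME v'. v' \<in> snd (quot_proj \<tau> v)) \<in> snd (quot_proj \<tau> v)"
      by (rule someI)
    then obtain u where u: "u \<in> span \<tau>" "(SOME v'. v' \<in> snd (quot_proj \<tau> v)) = v + u"
      unfolding quot_proj_def by auto
    then have "u \<in> span \<sigma>" using span_mono[OF face_of_imp_subset[OF that]] by blast
    with u(2) show ?thesis by (simp add: h_def q_span)
  qed
  have U_face: "\<tau> face_of \<sigma>" if "quot_proj \<tau> v \<in> U" for \<tau> v
    using that unfolding U_iff by (auto simp: quot_proj_eq_iff)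
  have U_open: "openin (N_Sigma N \<Sigma>) U"
    unfolding U_def N_Sigma_def
    by (intro openin_clauses(3) ballI) (use \<sigma> in \<open>auto simp: \<O>_def intro!: topology_generated_by_Basis\<close>)
  have "stratum N \<sigma> \<subseteq> U"
  proof
    fix y assume "y \<in> stratum N \<sigma>"
    then obtain p where p: "p \<in> span N" "y = quot_proj \<sigma> p" by (auto simp: stratum_def)
    obtain s where s: "s \<in> \<sigma>" "\<forall>x\<in>ball p 1. \<forall>t\<in>\<sigma>. F (x + s + t) = F (x + s) + 0"
      using F_add bounded_ball by (rule asymptotically_additiveE)
    have "F (x + t) = F x" if "x \<in> ball (p + s) 1" "t \<in> \<sigma>" for x t
    proof -
      have "x - s \<in> ball p 1" using that(1) by (simp add: dist_norm algebra_simps)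
      then show ?thesis using s(2) that(2) by fastforce
    qed
    then have "span N \<inter> ball (p + s) 1 \<in> \<O>"
      unfolding \<O>_def by (auto intro: convex_Int subspace_imp_convex bounded_Int openin_open_Int)
    moreover have "p + s \<in> span N \<inter> ball (p + s) 1"
      using p s cone(5)[OF \<sigma>] by (auto intro!: span_add)
    ultimately have "p + s + 0 \<in> R"
      unfolding R_def using convex_cone_contains_0[OF cone(1)[OF \<sigma>]] by blast
    moreover have "quot_proj \<sigma> p = quot_proj \<sigma> (p + s)"
      using span_neg[OF span_base[OF s(1)]] by (simp add: quot_proj_eq_iff)
    ultimately show "y \<in> U"
      unfolding U_iff using p \<sigma> face_of_refl[OF convex_of_cone[OF \<sigma>]] by auto
  qed
  moreover have "smooth_on_N_Sigma N \<Sigma> U h"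
    unfolding smooth_on_N_Sigma_def
  proof (intro conjI ballI)
    fix \<tau> assume "\<tau> \<in> \<Sigma>"
    show "Cinf_on (span N) {v \<in> span N. quot_proj \<tau> v \<in> U} (\<lambda>v. h (quot_proj \<tau> v))"
      unfolding Cinf_on_def
    proof (rule allI, rule Ck_on_cong[OF _ Ck_on_restrict[OF q]])
      fix v assume "v \<in> {v \<in> span N. quot_proj \<tau> v \<in> U}"
      then have "\<tau> face_of \<sigma>" using U_face by blast
      then show "h (quot_proj \<tau> v) = q v" by (rule h)
    qed
  next
    fix \<tau> x assume \<tau>: "\<tau> \<in> \<Sigma>" and x: "x \<in> U \<inter> stratum N \<tau>"
    then have face: "\<tau> face_of \<sigma>" using U_face by (auto simp: stratum_def)
    have "strata_proj \<tau> y \<in> U \<inter> stratum N \<tau> \<and> h y = h (strata_proj \<tau> y)"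
      if \<rho>: "\<rho> face_of \<tau>" and y: "y \<in> U \<inter> stratum N \<rho>" for \<rho> y
    proof -
      from y obtain \<rho>' v where "y = quot_proj \<rho>' v" "v \<in> R" "\<rho>' face_of \<sigma>"
        using U_iff[of y] by blast
      moreover from this y have "\<rho>' = \<rho>" by (auto simp: stratum_def quot_proj_eq_iff)
      ultimately have v: "y = quot_proj \<rho> v" "v \<in> R" "\<rho> face_of \<sigma>" by simp_all
      have "strata_proj \<tau> y = quot_proj \<tau> v"
        unfolding v(1) by (rule strata_proj_quot_proj[OF span_mono[OF face_of_imp_subset[OF \<rho>]]])
      moreover have "quot_proj \<tau> v \<in> U" unfolding U_iff using \<tau> face v(2) by blast
      moreover have "quot_proj \<tau> v \<in> stratum N \<tau>" using R_span[OF v(2)] by (simp add: stratum_def)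
      moreover have "h y = h (quot_proj \<tau> v)" using h face v by simp
      ultimately show ?thesis by simp
    qed
    then show "\<exists>V. openin (N_Sigma N \<Sigma>) V \<and> x \<in> V \<and> V \<subseteq> U \<and>
        (\<forall>\<rho>\<in>\<Sigma>. \<rho> face_of \<tau> \<longrightarrow>
           V \<inter> stratum N \<rho> = {y \<in> V \<inter> stratum N \<rho>. strata_proj \<tau> y \<in> V \<inter> stratum N \<tau>} \<and>
           (\<forall>y \<in> V \<inter> stratum N \<rho>. h y = h (strata_proj \<tau> y)))"
      using U_open x by (intro exI[of _ U]) blast
  qed
  moreover have "h (embed_NR v) = f v + m v" if v: "embed_NR v \<in> U" for v
  proof -
    from v have "v \<in> R" unfolding U_iff by (auto simp: quot_proj_eq_iff)
    then have "q v = f v + m v" using R_eq by (simp add: F_def)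
    then show ?thesis using h zero_cone[OF \<sigma>] by simp
  qed
  ultimately show "\<exists>U h. openin (N_Sigma N \<Sigma>) U \<and> stratum N \<sigma> \<subseteq> U \<and>
      smooth_on_N_Sigma N \<Sigma> U h \<and> (\<forall>v\<in>span N. embed_NR v \<in> U \<longrightarrow> h (embed_NR v) = f v + m v)"
    using U_open by blast
qed

section \<open>Approximation by smooth convex Green functions\<close>

theorem theorem5p4p4:
  fixes N :: "'a::euclidean_space set" and \<Sigma> :: "'a set set" and \<Psi> g :: "'a \<Rightarrow> real"
  assumes "is_lattice N"
    and "complete_fan N \<Sigma>"
    and "piecewise_linear_integral N \<Sigma> \<Psi>" and "concave_on (span N) \<Psi>"
    and "convex_on (span N) g" and "singular_Green_function N \<Sigma> \<Psi> g"
  shows "\<exists>G :: nat \<Rightarrow> 'a \<Rightarrow> real.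
           (\<forall>k. convex_on (span N) (G k) \<and> smooth_Green_function N \<Sigma> \<Psi> (G k)) \<and>
           (\<forall>v\<in>span N. decseq (\<lambda>k. G k v) \<and> (\<lambda>k. G k v) \<longlonglongrightarrow> g v)"
proof -
  interpret complete_rational_fan N \<Sigma>
    by unfold_locales (fact assms(2))
  note pl = assms(3)
  \<comment> \<open>Convolution needs functions on the whole ambient space, so \<open>g\<close> and \<open>\<Psi>\<close> are pulled back along a
     linear projection onto \<open>N\<^sub>\<real>\<close>.\<close>
  obtain p :: "'a \<Rightarrow> 'a" where p: "linear p" "range p \<subseteq> span N" "\<And>v. v \<in> span N \<Longrightarrow> p v = v"
    using linear_exists_left_inverse_on[OF linear_id subspace_span inj_on_id, of N] by auto
  have pN: "p v \<in> span N" for v using p(2) by blast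
  define H where "H v = - \<Psi> (p v)" for v
  have H_scale: "H (t *\<^sub>R v) = t * H v" if "0 \<le> t" for t v
    using piecewise_linear_scale[OF pl pN that] by (simp add: H_def linear_scale[OF p(1)])
  interpret sublinear_growth H "\<lambda>v. g (p v)"
  proof
    fix x y :: 'a
    \<comment> \<open>Concavity at the midpoint, doubled by homogeneity, gives subadditivity.\<close>
    have "\<Psi> ((1 - 1/2) *\<^sub>R p x + (1/2) *\<^sub>R p y) \<ge> (1 - 1/2) * \<Psi> (p x) + 1/2 * \<Psi> (p y)"
      by (intro concave_onD[OF assms(4)] pN) auto
    moreover have "\<Psi> ((1 - 1/2) *\<^sub>R p x + (1/2) *\<^sub>R p y) = 1/2 * \<Psi> (p (x + y))"
      using piecewise_linear_scale[OF pl pN, of "1/2" "x + y"]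
      by (simp add: linear_add[OF p(1)] scaleR_add_right)
    ultimately show "H (x + y) \<le> H x + H y" by (simp add: H_def)
  next
    show "convex_on UNIV (\<lambda>v. g (p v))"
    proof (rule convex_onI)
      fix t :: real and x y
      assume "0 < t" "t < 1"
      then show "g (p ((1 - t) *\<^sub>R x + t *\<^sub>R y)) \<le> (1 - t) * g (p x) + t * g (p y)"
        using convex_onD[OF assms(5) _ _ pN pN, of t x y]
        by (simp add: linear_add[OF p(1)] linear_scale[OF p(1)])
    qed simp
  next
    show "g (p (x + w)) \<le> g (p x) + H w" for x w
      using singular_Green_function_growth[OF pl assms(5,6) pN pN, of x w]
      by (simp add: H_def linear_add[OF p(1)])
  qed (fact H_scale)
  obtain G where G: "\<And>k. convex_on UNIV (G k)" "\<And>k n. Ck_on UNIV n UNIV (G k)"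
    "\<And>k x. G (Suc k) x \<le> G k x" "\<And>x. (\<lambda>k. G k x) \<longlonglongrightarrow> g (p x)"
    "\<And>k \<sigma>. asymptotically_additive H \<sigma> H \<Longrightarrow> asymptotically_additive H \<sigma> (G k)"
    by (rule smooth_decreasing_approximation) blast
  have "smooth_Green_function N \<Sigma> \<Psi> (G k)" for k
  proof (rule smooth_Green_functionI)
    fix \<sigma> assume \<sigma>: "\<sigma> \<in> \<Sigma>"
    then have "asymptotically_additive H \<sigma> (G k)"
      unfolding H_def using asymptotically_additive_support[OF pl _ p] G(5)[unfolded H_def] by blast
    moreover have "H t = - \<Psi> t" if "t \<in> \<sigma>" for t
      using that cone(5)[OF \<sigma>] p(3) by (auto simp: H_def)
    ultimately show "asymptotically_additive (\<lambda>v. - \<Psi> v) \<sigma> (G k)"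
      unfolding asymptotically_additive_def by simp
  qed (rule G(2))
  moreover have "convex_on (span N) (G k)" for k
    using G(1)[of k] subspace_imp_convex[OF subspace_span, of N] unfolding convex_on_def by simp
  moreover have "decseq (\<lambda>k. G k v)" for v
    using G(3) by (rule decseq_SucI)
  moreover have "(\<lambda>k. G k v) \<longlonglongrightarrow> g v" if "v \<in> span N" for v
    using G(4)[of v] p(3)[OF that] by simp
  ultimately show ?thesis by (intro exI[of _ G]) blast
qed

end
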